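(* Let $A$ be a natural Banach function algebra on a compact Hausdorff space $X$ with $\mathrm{ch}(A)=X$, and let $\varphi\colon A\to\mathbb{C}$ be a (not necessarily linear, not necessarily continuous) multiplicative spectral function. Let $x_0\in X$ be the associated point of $\varphi$, i.e. the unique point of $X$ such that $\varphi(e^f)=e^{f(x_0)}$ for all $f\in A$. Then: (i) Either $\ker(\varphi)$ is a maximal ideal of $A$, or $1=f_1+\cdots+f_n$ for some $f_1,\dots,f_n\in\ker(\varphi)$. (ii) Assume, furthermore, that $A$ has the Bishop property. If either $1\notin\mathrm{span}(\ker(\varphi))$ or $\varphi$ is continuous, then $\varphi(f)=f(x_0)$ for all $f\in A$ such that $\overline{f}\in A$.
   Context: For a compact Hausdorff space $X$, $C(X)$ is the algebra of continuous complex-valued functions on $X$, with supremum norm $\|\cdot\|_X$. A Banach function algebra on $X$ is a subalgebra $A$ of $C(X)$ that separates the points of $X$, contains the constant functions, and is a Banach algebra under some norm $\|\cdot\|$. It is natural if every character of $A$ is evaluation at some point of $X$; then $\sigma(f)=f(X)$ for all $f\in A$, where $\sigma(f)$ is the spectrum of $f$ in $A$. A function $\varphi\colon A\to\mathbb{C}$ is spectral if $\varphi(f)\in\sigma(f)$ for all $f\in A$, and multiplicative if $\varphi(fg)=\varphi(f)\varphi(g)$ for all $f,g\in A$. Here $\ker(\varphi)=\{f\in A:\varphi(f)=0\}$, and $\mathrm{span}$ is the complex linear span. Continuity of $\varphi$ is with respect to the norm of $A$. For a multiplicative spectral function $\varphi$ on a natural Banach function algebra $A$ on $X$, a known theorem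 of Maouche gives a unique point $x_0\in X$ with $\varphi(e^f)=e^{f(x_0)}$ for all $f\in A$; it is called the associated point of $\varphi$. The Choquet boundary $\mathrm{ch}(A)$ is the set of all $x\in X$ such that the evaluation functional $f\mapsto f(x)$ is an extreme point of the closed unit ball of the dual of $(A,\|\cdot\|_X)$. A peaking function of $A$ is an $f\in A$ with $1\in f(X)\subseteq\{z\in\mathbb{C}:|z|<1\}\cup\{1\}$. For $x\in X$, $P_{x}(A)$ is the set of all peaking functions $f\in A$ with $f(x)=1$. Put $\exp(A)=\{e^f:f\in A\}$ and $A_+=\{f\in A: f\ge 0\}$. A Banach function algebra $A$ on $X$ has the Bishop property if for each $x\in\mathrm{ch}(A)$ and each $f\in A$ with $f(x)\ne 0$ there exists $g\in P_x(A)$ such that $g\in\exp(A)\cup A_+$ and $\frac{1}{f(x)}fg\in P_x(A)$. *)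

theory Defs
  imports "HOL-Analysis.Analysis" "HOL-Algebra.Ideal" "HOL-Library.Function_Algebras"
begin

text \<open>
  The compact Hausdorff space \<open>X\<close> is a type \<open>'a :: t2_space\<close> with \<open>compact (UNIV :: 'a set)\<close>.
  Functions on \<open>X\<close> form the type \<open>'a \<Rightarrow> complex\<close> with the pointwise operations of
  \<^theory>\<open>HOL-Library.Function_Algebras\<close>; an algebra of functions is a set \<open>A\<close> of such functions.
  Maps defined on \<open>A\<close>, such as its norm, are total functions of which only the values on \<open>A\<close> matter.
\<close>

definition cscale :: "complex \<Rightarrow> ('a \<Rightarrow> complex) \<Rightarrow> ('a \<Rightarrow> complex)" where
  "cscale c f = (\<lambda>x. c * f x)"

lemma vector_space_cscale: "vector_space cscale"
  by unfold_locales (auto simp: cscale_def fun_eq_iff algebra_simps)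

abbreviation cspan :: "('a \<Rightarrow> complex) set \<Rightarrow> ('a \<Rightarrow> complex) set" where
  "cspan \<equiv> module.span cscale"

subsection \<open>Banach function algebras\<close>

definition function_algebra :: "('a::topological_space \<Rightarrow> complex) set \<Rightarrow> bool" where
  "function_algebra A \<longleftrightarrow>
     (\<forall>f\<in>A. continuous_on UNIV f) \<and>
     (\<forall>c. (\<lambda>x. c) \<in> A) \<and>
     (\<forall>f\<in>A. \<forall>g\<in>A. f + g \<in> A) \<and>
     (\<forall>c. \<forall>f\<in>A. cscale c f \<in> A) \<and>
     (\<forall>f\<in>A. \<forall>g\<in>A. f * g \<in> A) \<and>
     (\<forall>x y. x \<noteq> y \<longrightarrow> (\<exists>f\<in>A. f x \<noteq> f y))"

text \<open>
  \<^locale>\<open>Metric_space\<close> demands nonnegativity and symmetry on the whole type, hence the value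
  \<open>0\<close> outside \<open>A\<close>.
\<close>

definition ndist :: "('a \<Rightarrow> complex) set \<Rightarrow> (('a \<Rightarrow> complex) \<Rightarrow> real) \<Rightarrow>
    ('a \<Rightarrow> complex) \<Rightarrow> ('a \<Rightarrow> complex) \<Rightarrow> real" where
  "ndist A N f g = (if f \<in> A \<and> g \<in> A then N (f - g) else 0)"

text \<open>The normalisation \<open>N 1 = 1\<close> is not required of an algebra norm.\<close>

definition algebra_norm_on :: "('a \<Rightarrow> complex) set \<Rightarrow> (('a \<Rightarrow> complex) \<Rightarrow> real) \<Rightarrow> bool" where
  "algebra_norm_on A N \<longleftrightarrow>
     (\<forall>f\<in>A. 0 \<le> N f) \<and>
     (\<forall>f\<in>A. N f = 0 \<longleftrightarrow> f = 0) \<and>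
     (\<forall>c. \<forall>f\<in>A. N (cscale c f) = cmod c * N f) \<and>
     (\<forall>f\<in>A. \<forall>g\<in>A. N (f + g) \<le> N f + N g) \<and>
     (\<forall>f\<in>A. \<forall>g\<in>A. N (f * g) \<le> N f * N g)"

definition banach_function_algebra ::
    "('a::topological_space \<Rightarrow> complex) set \<Rightarrow> (('a \<Rightarrow> complex) \<Rightarrow> real) \<Rightarrow> bool" where
  "banach_function_algebra A N \<longleftrightarrow>
     function_algebra A \<and> algebra_norm_on A N \<and> Metric_space.mcomplete A (ndist A N)"

lemma Metric_space_ndist:
  assumes "function_algebra A" and "algebra_norm_on A N"
  shows "Metric_space A (ndist A N)"
proof -
  have diff: "f - g \<in> A" if "f \<in> A" "g \<in> A" for f g
  proof -
    have "f + cscale (-1) g \<in> A" using that assms(1) by (simp add: function_algebra_def)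
    moreover have "f + cscale (-1) g = f - g" by (auto simp: cscale_def fun_eq_iff)
    ultimately show ?thesis by simp
  qed
  have sym: "N (f - g) = N (g - f)" if "f \<in> A" "g \<in> A" for f g
  proof -
    have "f - g = cscale (-1) (g - f)" by (auto simp: cscale_def fun_eq_iff)
    then show ?thesis using diff[OF that(2,1)] assms(2) by (simp add: algebra_norm_on_def)
  qed
  have tri: "N (f - h) \<le> N (f - g) + N (g - h)" if "f \<in> A" "g \<in> A" "h \<in> A" for f g h
  proof -
    have "\<forall>p\<in>A. \<forall>q\<in>A. N (p + q) \<le> N p + N q"
      using assms(2) by (simp add: algebra_norm_on_def)
    from this[rule_format, OF diff[OF that(1,2)] diff[OF that(2,3)]]
    show ?thesis by simp
  qed
  have zero: "N (f - g) = 0 \<longleftrightarrow> f = g" if "f \<in> A" "g \<in> A" for f g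
    using diff[OF that] assms(2) by (auto simp: algebra_norm_on_def)
  have nonneg: "0 \<le> N (f - g)" if "f \<in> A" "g \<in> A" for f g
    using diff[OF that] assms(2) by (simp add: algebra_norm_on_def)
  show ?thesis
  proof
    fix f g h
    show "0 \<le> ndist A N f g" by (simp add: ndist_def nonneg)
    show "ndist A N f g = ndist A N g f" using sym[of f g] by (auto simp: ndist_def)
    show "ndist A N f g = 0 \<longleftrightarrow> f = g" if "f \<in> A" "g \<in> A"
      using zero[OF that] that by (simp add: ndist_def)
    show "ndist A N f h \<le> ndist A N f g + ndist A N g h" if "f \<in> A" "g \<in> A" "h \<in> A"
      using tri[OF that] that by (simp add: ndist_def)
  qed
qed

definition fun_ring :: "('a \<Rightarrow> complex) set \<Rightarrow> ('a \<Rightarrow> complex) ring" where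
  "fun_ring A = \<lparr>carrier = A, mult = (*), one = 1, zero = 0, add = (+)\<rparr>"

definition spectrum :: "('a \<Rightarrow> complex) set \<Rightarrow> ('a \<Rightarrow> complex) \<Rightarrow> complex set" where
  "spectrum A f = {c. f - (\<lambda>x. c) \<notin> Units (fun_ring A)}"

definition linear_functional_on ::
    "('a \<Rightarrow> complex) set \<Rightarrow> (('a \<Rightarrow> complex) \<Rightarrow> complex) \<Rightarrow> bool" where
  "linear_functional_on A \<psi> \<longleftrightarrow>
     (\<forall>f\<in>A. \<forall>g\<in>A. \<psi> (f + g) = \<psi> f + \<psi> g) \<and>
     (\<forall>c. \<forall>f\<in>A. \<psi> (cscale c f) = c * \<psi> f)"

definition multiplicative_on ::
    "('a \<Rightarrow> complex) set \<Rightarrow> (('a \<Rightarrow> complex) \<Rightarrow> complex) \<Rightarrow> bool" where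
  "multiplicative_on A \<phi> \<longleftrightarrow> (\<forall>f\<in>A. \<forall>g\<in>A. \<phi> (f * g) = \<phi> f * \<phi> g)"

definition character_on ::
    "('a \<Rightarrow> complex) set \<Rightarrow> (('a \<Rightarrow> complex) \<Rightarrow> complex) \<Rightarrow> bool" where
  "character_on A \<psi> \<longleftrightarrow>
     linear_functional_on A \<psi> \<and> multiplicative_on A \<psi> \<and> (\<exists>f\<in>A. \<psi> f \<noteq> 0)"

definition natural :: "('a \<Rightarrow> complex) set \<Rightarrow> bool" where
  "natural A \<longleftrightarrow> (\<forall>\<psi>. character_on A \<psi> \<longrightarrow> (\<exists>x. \<forall>f\<in>A. \<psi> f = f x))"

subsection \<open>Multiplicative spectral functions\<close>

definition spectral_on ::
    "('a \<Rightarrow> complex) set \<Rightarrow> (('a \<Rightarrow> complex) \<Rightarrow> complex) \<Rightarrow> bool" where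
  "spectral_on A \<phi> \<longleftrightarrow> (\<forall>f\<in>A. \<phi> f \<in> spectrum A f)"

definition kernel_on ::
    "('a \<Rightarrow> complex) set \<Rightarrow> (('a \<Rightarrow> complex) \<Rightarrow> complex) \<Rightarrow> ('a \<Rightarrow> complex) set" where
  "kernel_on A \<phi> = {f \<in> A. \<phi> f = 0}"

text \<open>
  The norm of a Banach function algebra dominates the supremum norm, so the exponential
  series of \<open>f\<close> in \<open>A\<close> converges to the pointwise exponential \<open>exp \<circ> f\<close>.
\<close>

definition associated_point ::
    "('a \<Rightarrow> complex) set \<Rightarrow> (('a \<Rightarrow> complex) \<Rightarrow> complex) \<Rightarrow> 'a \<Rightarrow> bool" where
  "associated_point A \<phi> x \<longleftrightarrow> (\<forall>f\<in>A. \<phi> (exp \<circ> f) = exp (f x))"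

lemma associated_point_unique:
  assumes "function_algebra A" "associated_point A \<phi> x" "associated_point A \<phi> y"
  shows "x = y"
proof (rule ccontr)
  assume "x \<noteq> y"
  then obtain f where f: "f \<in> A" "f x \<noteq> f y"
    using assms(1) unfolding function_algebra_def by blast
  define c where "c = 1 / (f x - f y)"
  have "cscale c f \<in> A" using f(1) assms(1) by (simp add: function_algebra_def)
  then have "exp (cscale c f x) = exp (cscale c f y)"
    using assms(2,3) by (simp add: associated_point_def)
  moreover have "cscale c f x = cscale c f y + 1"
  proof -
    have "c * (f x - f y) = 1" using f(2) by (simp add: c_def)
    then show ?thesis by (simp add: cscale_def algebra_simps)
  qed
  ultimately have "exp (cscale c f y) * exp 1 = exp (cscale c f y)"
    by (simp add: exp_add)
  then have "exp 1 = (1::complex)" by simp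
  then have "cmod (exp 1) = 1" by simp
  then show False by simp
qed

subsection \<open>Choquet boundary and the Bishop property\<close>

definition sup_norm :: "('a \<Rightarrow> complex) \<Rightarrow> real" where
  "sup_norm f = (SUP x. cmod (f x))"

text \<open>
  Elements of the dual of \<open>A\<close> are represented by functionals in \<^term>\<open>extensional A\<close>, so that
  functionals agreeing on \<open>A\<close> are equal.
\<close>

definition dual_ball :: "('a \<Rightarrow> complex) set \<Rightarrow> (('a \<Rightarrow> complex) \<Rightarrow> complex) set" where
  "dual_ball A = {\<psi> \<in> extensional A. linear_functional_on A \<psi> \<and>
     (\<forall>f\<in>A. cmod (\<psi> f) \<le> sup_norm f)}"

definition eval_on :: "('a \<Rightarrow> complex) set \<Rightarrow> 'a \<Rightarrow> ('a \<Rightarrow> complex) \<Rightarrow> complex" where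
  "eval_on A x = (\<lambda>f\<in>A. f x)"

text \<open>
  The functionals do not form a type of class \<^class>\<open>real_vector\<close>, so the definition of
  \<^const>\<open>extreme_point_of\<close> is written out.
\<close>

definition choquet_boundary :: "('a \<Rightarrow> complex) set \<Rightarrow> 'a set" where
  "choquet_boundary A = {x. eval_on A x \<in> dual_ball A \<and>
     \<not> (\<exists>\<psi>\<^sub>1\<in>dual_ball A. \<exists>\<psi>\<^sub>2\<in>dual_ball A. \<psi>\<^sub>1 \<noteq> \<psi>\<^sub>2 \<and>
          (\<exists>u::real. 0 < u \<and> u < 1 \<and>
             eval_on A x = (\<lambda>f\<in>A. of_real (1 - u) * \<psi>\<^sub>1 f + of_real u * \<psi>\<^sub>2 f)))}"

definition peaking_at :: "('a \<Rightarrow> complex) set \<Rightarrow> 'a \<Rightarrow> ('a \<Rightarrow> complex) set" where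
  "peaking_at A x = {f \<in> A. 1 \<in> range f \<and> range f \<subseteq> {z. cmod z < 1} \<union> {1} \<and> f x = 1}"

definition exp_set :: "('a \<Rightarrow> complex) set \<Rightarrow> ('a \<Rightarrow> complex) set" where
  "exp_set A = {exp \<circ> f | f. f \<in> A}"

definition nonneg_part :: "('a \<Rightarrow> complex) set \<Rightarrow> ('a \<Rightarrow> complex) set" where
  "nonneg_part A = {f \<in> A. \<forall>x. f x \<in> \<real>\<^sub>\<ge>\<^sub>0}"

definition bishop_property :: "('a \<Rightarrow> complex) set \<Rightarrow> bool" where
  "bishop_property A \<longleftrightarrow>
     (\<forall>x\<in>choquet_boundary A. \<forall>f\<in>A. f x \<noteq> 0 \<longrightarrow>
        (\<exists>g\<in>peaking_at A x. g \<in> exp_set A \<union> nonneg_part A \<and>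
           cscale (1 / f x) (f * g) \<in> peaking_at A x))"

end

theory Submission
  imports Defs
begin

text \<open>
  If \<open>\<bar>\<phi> f\<bar> > \<bar>f x\<^sub>0\<bar>\<close>, then evaluating \<open>\<phi>\<close> on the functions \<open>f e\<^sup>g\<close> with \<open>g \<in> A\<close> shows, by a Hahn--Banach
  argument, that a probability measure other than the point mass represents \<open>x\<^sub>0\<close>, which contradicts
  \<open>x\<^sub>0 \<in> ch(A)\<close>. Hence \<open>\<bar>\<phi> f\<bar> \<le> \<bar>f x\<^sub>0\<bar>\<close>, so the kernel of \<open>\<phi>\<close> contains the maximal ideal of \<open>x\<^sub>0\<close>. If it contains
  some \<open>f\<close> with \<open>f x\<^sub>0 = 1\<close> as well, then \<open>1 = f + (1 - f)\<close>.

  For \<open>u \<ge> 0\<close> the value of \<open>\<phi>\<close> on \<open>u e\<^sup>g\<close> for a suitable imaginary \<open>g\<close> gives \<open>\<phi> u \<in> {0, u x\<^sub>0}\<close>. Each hypothesis of (ii) excludes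
  the value \<open>0\<close> when \<open>u x\<^sub>0 \<noteq> 0\<close>. Taking \<open>u = \<bar>f\<bar>\<^sup>2\<close> shows \<open>\<bar>\<phi> f\<bar> = \<bar>f x\<^sub>0\<bar>\<close>; by the Bishop property \<open>\<phi> f / f x\<^sub>0\<close> is a value
  of a peaking function, and having modulus 1 it equals 1.
\<close>

subsection \<open>Algebra norms\<close>

lemma fun_power_apply: "(f ^ n) x = f x ^ n" for f :: "'a \<Rightarrow> complex"
  by (induction n) auto

lemma fun_sum_apply: "(\<Sum>i\<in>I. f i) x = (\<Sum>i\<in>I. f i x)" for f :: "'i \<Rightarrow> 'a \<Rightarrow> complex"
  by (induction I rule: infinite_finite_induct) auto

lemma cscale_apply [simp]: "cscale c f x = c * f x"
  by (simp add: cscale_def)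

locale banach_fun_alg =
  fixes A :: "('a::topological_space \<Rightarrow> complex) set" and N :: "('a \<Rightarrow> complex) \<Rightarrow> real"
  assumes bfa: "banach_function_algebra A N"
begin

lemma fa: "function_algebra A" and norm_on: "algebra_norm_on A N"
  and complete: "Metric_space.mcomplete A (ndist A N)"
  using bfa by (auto simp: banach_function_algebra_def)

lemma A_continuous: "f \<in> A \<Longrightarrow> continuous_on UNIV f"
  and A_const: "(\<lambda>x. c) \<in> A"
  and A_add [intro]: "f \<in> A \<Longrightarrow> g \<in> A \<Longrightarrow> f + g \<in> A"
  and A_cscale [intro]: "f \<in> A \<Longrightarrow> cscale c f \<in> A"
  and A_mult [intro]: "f \<in> A \<Longrightarrow> g \<in> A \<Longrightarrow> f * g \<in> A"
  and A_separates: "x \<noteq> y \<Longrightarrow> \<exists>f\<in>A. f x \<noteq> f y"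
  using fa by (auto simp: function_algebra_def)

lemma A_zero [simp]: "0 \<in> A" and A_one [simp]: "1 \<in> A"
  using A_const[of 0] A_const[of 1] by (simp_all add: zero_fun_def one_fun_def)

lemma A_uminus [intro]: "f \<in> A \<Longrightarrow> - f \<in> A"
  using A_cscale[of f "-1"] by (simp add: cscale_def fun_Compl_def)

lemma A_diff [intro]: "f \<in> A \<Longrightarrow> g \<in> A \<Longrightarrow> f - g \<in> A"
  using A_add[of f "- g"] by auto

lemma A_power [intro]: "f \<in> A \<Longrightarrow> f ^ n \<in> A"
  by (induction n) auto

lemma A_sum: "(\<And>i. i \<in> I \<Longrightarrow> f i \<in> A) \<Longrightarrow> (\<Sum>i\<in>I. f i) \<in> A"
  by (induction I rule: infinite_finite_induct) auto

lemma N_nonneg [simp]: "f \<in> A \<Longrightarrow> 0 \<le> N f"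
  and N_eq_0_iff: "f \<in> A \<Longrightarrow> N f = 0 \<longleftrightarrow> f = 0"
  and N_cscale: "f \<in> A \<Longrightarrow> N (cscale c f) = cmod c * N f"
  and N_triangle: "f \<in> A \<Longrightarrow> g \<in> A \<Longrightarrow> N (f + g) \<le> N f + N g"
  and N_mult: "f \<in> A \<Longrightarrow> g \<in> A \<Longrightarrow> N (f * g) \<le> N f * N g"
  using norm_on by (auto simp: algebra_norm_on_def)

lemma N_minus_commute: "f \<in> A \<Longrightarrow> g \<in> A \<Longrightarrow> N (f - g) = N (g - f)"
  using N_cscale[of "g - f" "-1"] A_diff[of g f]
  by (simp add: cscale_def fun_diff_def)

text \<open>The factor \<open>N 1\<close> covers \<open>n = 0\<close>, because an algebra norm may
  give the unit a norm other than 1.\<close>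

lemma N_power: "f \<in> A \<Longrightarrow> N (f ^ n) \<le> N 1 * N f ^ n"
proof (induction n)
  case (Suc n)
  have "N (f ^ n * f) \<le> N (f ^ n) * N f"
    using Suc by (intro N_mult) auto
  also have "\<dots> \<le> N 1 * N f ^ n * N f"
    by (rule mult_right_mono[OF Suc.IH[OF Suc.prems] N_nonneg[OF Suc.prems]])
  finally show ?case
    unfolding power_Suc2 by (simp only: mult.assoc)
qed auto

lemma N_sum: "(\<And>i. i \<in> I \<Longrightarrow> f i \<in> A) \<Longrightarrow> N (\<Sum>i\<in>I. f i) \<le> (\<Sum>i\<in>I. N (f i))"
proof (induction I rule: infinite_finite_induct)
  case (insert i I)
  then have "N (f i + sum f I) \<le> N (f i) + N (sum f I)"
    by (intro N_triangle A_sum) auto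
  also have "N (f i) + N (sum f I) \<le> N (f i) + (\<Sum>i\<in>I. N (f i))"
    using insert by (intro add_left_mono) simp
  finally show ?case
    unfolding sum.insert[OF insert.hyps] .
qed (use N_eq_0_iff[of 0] in auto)

text \<open>Completeness in the form used for the geometric and the exponential series: tails of the
  norm series bound the differences of partial sums, which are therefore Cauchy.\<close>

lemma absolutely_convergent_series:
  assumes f: "\<And>n::nat. f n \<in> A" and sm: "summable (\<lambda>n. N (f n))"
  obtains s where "s \<in> A" "(\<lambda>n. N (s - (\<Sum>k<n. f k))) \<longlonglongrightarrow> 0"
proof -
  interpret Metric_space A "ndist A N"
    using Metric_space_ndist[OF fa norm_on] .
  define S where "S n = (\<Sum>k<n. f k)" for n
  have S: "S n \<in> A" for n
    unfolding S_def using f by (intro A_sum) auto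
  have tail: "N (S n - S m) \<le> (\<Sum>k\<in>{m..<n}. N (f k))" if "m \<le> n" for m n
  proof -
    have "S n - S m = (\<Sum>k\<in>{m..<n}. f k)"
      using that sum_diff_nat_ivl[of 0 m n f] by (simp add: S_def atLeast0LessThan)
    then show ?thesis using N_sum[of "{m..<n}" f] f by simp
  qed
  have "MCauchy S"
    unfolding MCauchy_def
  proof (intro conjI allI impI)
    show "range S \<subseteq> A" using S by auto
    fix e :: real assume "e > 0"
    then obtain K where K: "\<And>m n. m \<ge> K \<Longrightarrow> norm (\<Sum>k\<in>{m..<n}. N (f k)) < e"
      using sm unfolding summable_Cauchy by blast
    have lt: "N (S n - S m) < e" if "K \<le> m" "m \<le> n" for m n
      using tail[OF that(2)] K[OF that(1), of n] by simp
    show "\<exists>K. \<forall>n n'. K \<le> n \<longrightarrow> K \<le> n' \<longrightarrow> ndist A N (S n) (S n') < e"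
    proof (intro exI allI impI)
      fix n n' assume "K \<le> n" "K \<le> n'"
      then show "ndist A N (S n) (S n') < e"
        using lt[of n n'] lt[of n' n] S N_minus_commute[of "S n" "S n'"]
        by (cases "n \<le> n'") (auto simp: ndist_def)
    qed
  qed
  then obtain s where lim: "limitin mtopology S s sequentially"
    using complete unfolding mcomplete_def by blast
  then have s: "s \<in> A" and close: "\<And>e. e > 0 \<Longrightarrow> \<exists>K. \<forall>n\<ge>K. ndist A N (S n) s < e"
    unfolding limit_metric_sequentially by blast+
  have "(\<lambda>n. N (s - S n)) \<longlonglongrightarrow> 0"
  proof (rule LIMSEQ_I)
    fix e :: real assume "e > 0"
    then obtain K where "\<forall>n\<ge>K. ndist A N (S n) s < e" using close by blast
    then show "\<exists>K. \<forall>n\<ge>K. norm (N (s - S n) - 0) < e"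
      using S s N_minus_commute[OF s S] N_nonneg[OF A_diff[OF S s]]
      by (intro exI[of _ K]) (auto simp: ndist_def)
  qed
  then show ?thesis using that s unfolding S_def by blast
qed

text \<open>The inverse is the geometric series \<open>g\<close> of \<open>f\<close>: its partial
  sums \<open>S\<close> satisfy \<open>(1 - f) * S = 1 - f ^ n\<close>, and \<open>N (f ^ n)\<close>
  tends to 0.\<close>

lemma neumann:
  assumes f: "f \<in> A" and less: "N f < 1"
  shows "\<exists>g\<in>A. (1 - f) * g = 1"
proof -
  have "summable (\<lambda>n. N 1 * N f ^ n)"
    using less N_nonneg[OF f] by (intro summable_mult summable_geometric) simp
  then have "summable (\<lambda>n. N (f ^ n))"
    by (rule summable_comparison_test'[where N = 0]) (use f N_power A_power in auto)
  with f obtain g where g: "g \<in> A" and lim: "(\<lambda>n. N (g - (\<Sum>k<n. f ^ k))) \<longlonglongrightarrow> 0"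
    using absolutely_convergent_series[of "\<lambda>n. f ^ n"] by auto
  \<comment> \<open>A null sequence of upper bounds for the fixed number
    \<open>N ((1 - f) * g - 1)\<close>.\<close>
  define e where "e n = N (1 - f) * N (g - (\<Sum>k<n. f ^ k)) + N 1 * N f ^ n" for n
  have pow: "(\<lambda>n. N f ^ n) \<longlonglongrightarrow> 0"
    using LIMSEQ_realpow_zero[OF N_nonneg[OF f] less] .
  have "e \<longlonglongrightarrow> N (1 - f) * 0 + N 1 * 0"
    unfolding e_def by (intro tendsto_add tendsto_mult_left lim pow)
  moreover have "N ((1 - f) * g - 1) \<le> e n" for n
  proof -
    define S where "S = (\<Sum>k<n. f ^ k)"
    have S: "S \<in> A" unfolding S_def using f by (intro A_sum) auto
    have "(1 - f) * S = 1 - f ^ n"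
      unfolding S_def by (rule one_diff_power_eq[symmetric])
    then have "(1 - f) * g - 1 = (1 - f) * (g - S) + cscale (-1) (f ^ n)"
      by (simp add: fun_eq_iff algebra_simps)
    then have "N ((1 - f) * g - 1) \<le> N ((1 - f) * (g - S)) + N (cscale (-1) (f ^ n))"
      using f g S by (simp only: N_triangle A_cscale A_diff A_mult A_one A_power)
    also have "\<dots> \<le> N (1 - f) * N (g - S) + N (f ^ n)"
      using N_mult[OF A_diff[OF A_one f] A_diff[OF g S]] N_cscale[OF A_power[OF f], of "-1"] by simp
    also have "\<dots> \<le> e n"
      unfolding e_def S_def using N_power[OF f] by (rule add_left_mono)
    finally show ?thesis .
  qed
  ultimately have "N ((1 - f) * g - 1) \<le> 0"
    by (intro LIMSEQ_le_const[of e 0]) auto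
  then have "N ((1 - f) * g - 1) = 0"
    by (intro antisym N_nonneg A_diff A_mult f g A_one)
  then show ?thesis
    using g N_eq_0_iff[OF A_diff[OF A_mult[OF A_diff[OF A_one f] g] A_one]]
    by (intro bexI[of _ g]) simp_all
qed

text \<open>If \<open>N f < |f x|\<close>, the Neumann series inverts \<open>1 - f / f x\<close>,
  which vanishes at \<open>x\<close>. Norm convergence in \<open>A\<close> therefore implies
  pointwise convergence.\<close>

lemma cmod_le_N:
  assumes f: "f \<in> A" shows "cmod (f x) \<le> N f"
proof (rule ccontr)
  assume "\<not> ?thesis"
  then have less: "N f < cmod (f x)" by simp
  moreover from this have pos: "0 < cmod (f x)" using N_nonneg[OF f] by linarith
  ultimately have "N (cscale (1 / f x) f) < 1"
    using f by (simp add: N_cscale norm_divide)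
  then obtain g where g: "(1 - cscale (1 / f x) f) * g = 1"
    using neumann[OF A_cscale[OF f]] by blast
  have "((1 - cscale (1 / f x) f) * g) x = 1" unfolding g by simp
  then show False using pos by auto
qed

text \<open>The exponential series converges absolutely in \<open>A\<close>; since the norm
  dominates point evaluations, its sum is the pointwise exponential.\<close>

lemma exp_in_A:
  assumes f: "f \<in> A" shows "exp \<circ> f \<in> A"
proof -
  define c where "c n = cscale (1 / fact n) (f ^ n)" for n
  have c: "c n \<in> A" for n unfolding c_def using f by auto
  have "summable (\<lambda>n. N 1 * (inverse (fact n) * N f ^ n))"
    by (intro summable_mult summable_exp)
  then have "summable (\<lambda>n. N (c n))"
  proof (rule summable_comparison_test'[where N = 0])
    fix n :: nat
    have "N (c n) = N (f ^ n) / fact n"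
      using N_cscale[OF A_power[OF f]] by (simp add: c_def norm_divide)
    also have "\<dots> \<le> N 1 * N f ^ n / fact n"
      by (intro divide_right_mono N_power f) auto
    finally show "norm (N (c n)) \<le> N 1 * (inverse (fact n) * N f ^ n)"
      using N_nonneg[OF c[of n]] by (simp add: divide_inverse ac_simps)
  qed
  then obtain s where s: "s \<in> A" and lim: "(\<lambda>n. N (s - (\<Sum>k<n. c k))) \<longlonglongrightarrow> 0"
    by (rule absolutely_convergent_series[OF c])
  have "s x = exp (f x)" for x
  proof -
    have "(\<lambda>n. s x - (\<Sum>k<n. c k x)) \<longlonglongrightarrow> 0"
    proof (rule Lim_null_comparison[OF _ lim], rule always_eventually, rule allI)
      fix n
      have "s - (\<Sum>k<n. c k) \<in> A" using s c by (intro A_diff A_sum) auto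
      from cmod_le_N[OF this, of x]
      show "norm (s x - (\<Sum>k<n. c k x)) \<le> N (s - (\<Sum>k<n. c k))"
        by (simp add: fun_sum_apply)
    qed
    from tendsto_diff[OF tendsto_const[of "s x"] this]
    have "(\<lambda>n. c n x) sums s x" by (simp add: sums_def)
    moreover have "(\<lambda>n. c n x) sums exp (f x)"
      using exp_converges[of "f x"]
      by (simp add: c_def fun_power_apply scaleR_conv_of_real divide_inverse)
    ultimately show ?thesis by (rule sums_unique2)
  qed
  then have "exp \<circ> f = s" by auto
  with s show ?thesis by simp
qed

end

subsection \<open>Maximal ideals and the Gelfand--Mazur theorem\<close>

text \<open>
  The hypotheses hold for \<open>F c = q ((f - c)\<^sup>-\<^sup>1)\<close> in a normed field: \<open>F\<close> is subharmonic up to a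
  third-order error and vanishes at infinity, so \<open>F c + \<epsilon> \<bar>c\<bar>\<^sup>2\<close> violates the maximum principle on a large disc.
\<close>

lemma no_resolvent_norm:
  fixes F :: "complex \<Rightarrow> real"
  assumes pos: "\<And>c. 0 < F c"
    and lip: "\<And>c d. \<bar>F c - F d\<bar> \<le> cmod (c - d) * F c * F d"
    and decay: "\<And>c. cmod c * F c \<le> a * F c + b"
    and mean: "\<And>c h. 4 * F c \<le> F (c + h) + F (c - h) + F (c + \<i> * h) + F (c - \<i> * h)
       + cmod h ^ 3 * F c ^ 3 * (F (c + h) + F (c - h) + F (c + \<i> * h) + F (c - \<i> * h))"
  shows False
proof -
  \<comment> \<open>Dividing \<open>lip\<close> by \<open>F c * F d\<close> shows that
    \<open>1 / F\<close> is 1-Lipschitz; hence \<open>F\<close> is continuous, as the maximum on a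
    disc requires.\<close>
  have inv_lip: "\<bar>1 / F c - 1 / F d\<bar> \<le> cmod (c - d)" for c d
  proof -
    have "1 / F c - 1 / F d = (F d - F c) / (F c * F d)"
      using pos[of c] pos[of d] by (simp add: field_simps)
    also have "\<bar>\<dots>\<bar> = \<bar>F c - F d\<bar> / (F c * F d)"
      using pos[of c] pos[of d] by (simp add: abs_mult abs_minus_commute)
    also have "\<dots> \<le> cmod (c - d)"
      using lip[of c d] pos[of c] pos[of d] by (simp add: pos_divide_le_eq mult.assoc)
    finally show ?thesis .
  qed
  have "1-lipschitz_on UNIV (\<lambda>c. 1 / F c)"
    by (rule lipschitz_onI) (use inv_lip in \<open>auto simp: dist_real_def dist_norm\<close>)
  then have "continuous_on UNIV (\<lambda>c. 1 / (1 / F c))"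
    by (intro continuous_intros lipschitz_on_continuous_on) (use pos in \<open>auto simp: less_imp_neq[symmetric]\<close>)
  then have cont: "continuous_on UNIV F" by simp
  \<comment> \<open>On the circle of radius \<open>T\<close>, \<open>decay\<close> reads
    \<open>(T - a) * F c \<le> b\<close>. As \<open>T - a\<close> is at least 1, \<open>b\<close> is
    positive; as it is at least \<open>2 * \<bar>b\<bar> / F 0\<close>, it follows that
    \<open>F c \<le> F 0 / 2\<close>.\<close>
  define T where "T = 1 + \<bar>a\<bar> + 2 * \<bar>b\<bar> / F 0"
  have T: "0 < T" using pos[of 0] by (simp add: T_def add_pos_nonneg)
  have far: "F c \<le> F 0 / 2" if "cmod c = T" for c
  proof -
    have "0 \<le> 2 * \<bar>b\<bar> / F 0" using pos[of 0] by simp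
    then have Ta: "2 * \<bar>b\<bar> / F 0 \<le> T - a" "1 \<le> T - a" unfolding T_def by linarith+
    then have "2 * \<bar>b\<bar> / F 0 * F c \<le> (T - a) * F c"
      using pos[of c] Ta by (intro mult_right_mono) auto
    also have "\<dots> \<le> \<bar>b\<bar>" using decay[of c] that by (simp add: algebra_simps)
    finally have A: "2 * \<bar>b\<bar> * F c \<le> \<bar>b\<bar> * F 0"
      using pos[of 0] by (simp add: field_simps)
    have "1 * F c \<le> (T - a) * F c"
      using pos[of c] Ta by (intro mult_right_mono) auto
    also have "\<dots> \<le> b" using decay[of c] that by (simp add: algebra_simps)
    finally have "0 < \<bar>b\<bar>" using pos[of c] by linarith
    then show ?thesis using A by simp
  qed
  \<comment> \<open>This size keeps \<open>u\<close> at most \<open>3 / 4 * F 0\<close> on the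
    circle, below \<open>u 0 = F 0\<close>, so the maximum of \<open>u\<close> lies inside.\<close>
  define e where "e = F 0 / (4 * T\<^sup>2)"
  have e: "0 < e" using pos[of 0] T by (simp add: e_def)
  define u where "u c = F c + e * (cmod c)\<^sup>2" for c
  have "continuous_on (cball 0 T) u"
    unfolding u_def by (intro continuous_intros continuous_on_subset[OF cont]) auto
  then obtain c where c: "c \<in> cball 0 T" and max: "\<And>d. d \<in> cball 0 T \<Longrightarrow> u d \<le> u c"
    using continuous_attains_sup[of "cball 0 T" u] T by (auto simp: Ball_def)
  have "u 0 \<le> u c" using max[of 0] T by simp
  then have "F 0 \<le> u c" by (simp add: u_def)
  moreover have "u c \<le> 3 / 4 * F 0" if "cmod c = T"
    using far[OF that] that T by (simp add: u_def e_def)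
  ultimately have inner: "cmod c < T"
    using c pos[of 0] by (cases "cmod c = T") auto
  define K where "K = F c ^ 3 * u c"
  have K: "0 < K" using pos[of c] e by (simp add: K_def u_def add_pos_nonneg)
  \<comment> \<open>The first bound keeps the circle of radius \<open>r\<close> about
    \<open>c\<close> in the disc; the second makes the cubic error
    \<open>4 * r ^ 3 * F c ^ 3 * u c\<close> at most \<open>2 * e * r\<^sup>2\<close>, half the gain
    from the quadratic term of \<open>u\<close>.\<close>
  define r where "r = min (T - cmod c) (e / (2 * K))"
  have r: "0 < r" using inner e K by (simp add: r_def)
  have ball: "c + h \<in> cball 0 T" if "cmod h = r" for h
    using norm_triangle_ineq[of c h] that by (simp add: r_def)
  have F_le: "F (c + h) \<le> u c - e * (cmod (c + h))\<^sup>2" if "cmod h = r" for h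
    using max[OF ball[OF that]] by (simp add: u_def)
  have F_le': "F (c + h) \<le> u c" if "cmod h = r" for h
    using F_le[OF that] e by (smt (verit) mult_nonneg_nonneg zero_le_power2)
  let ?h = "complex_of_real r"
  define S where "S = F (c + ?h) + F (c - ?h) + F (c + \<i> * ?h) + F (c - \<i> * ?h)"
  have nr: "cmod ?h = r" "cmod (- ?h) = r" "cmod (\<i> * ?h) = r" "cmod (- (\<i> * ?h)) = r"
    using r by (auto simp: norm_mult)
  \<comment> \<open>The cross terms cancel in opposite pairs, leaving a gain of
    \<open>r\<^sup>2\<close> per point.\<close>
  have sq: "(cmod (c + ?h))\<^sup>2 + (cmod (c - ?h))\<^sup>2 + (cmod (c + \<i> * ?h))\<^sup>2 + (cmod (c - \<i> * ?h))\<^sup>2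
      = 4 * (cmod c)\<^sup>2 + 4 * r\<^sup>2"
    unfolding cmod_power2 by (simp add: power2_eq_square algebra_simps)
  have "S \<le> 4 * u c - e * ((cmod (c + ?h))\<^sup>2 + (cmod (c - ?h))\<^sup>2
      + (cmod (c + \<i> * ?h))\<^sup>2 + (cmod (c - \<i> * ?h))\<^sup>2)"
    using F_le[OF nr(1)] F_le[OF nr(2)] F_le[OF nr(3)] F_le[OF nr(4)]
    unfolding S_def by (simp add: algebra_simps)
  then have S1: "S \<le> 4 * F c - 4 * e * r\<^sup>2"
    unfolding sq by (simp add: u_def algebra_simps)
  have S2: "S \<le> 4 * u c"
    using F_le'[OF nr(1)] F_le'[OF nr(2)] F_le'[OF nr(3)] F_le'[OF nr(4)]
    unfolding S_def by simp
  have "4 * F c \<le> S + r ^ 3 * F c ^ 3 * S"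
    using mean[of c ?h] nr unfolding S_def by simp
  also have "r ^ 3 * F c ^ 3 * S \<le> r ^ 3 * F c ^ 3 * (4 * u c)"
    using S2 r pos[of c] by (intro mult_left_mono) auto
  also have "r ^ 3 * F c ^ 3 * (4 * u c) = r\<^sup>2 * (4 * (r * K))"
    by (simp add: K_def power2_eq_square power3_eq_cube)
  also have "\<dots> \<le> r\<^sup>2 * (4 * (e / 2))"
  proof -
    have "r * K \<le> e / (2 * K) * K" using K by (intro mult_right_mono) (auto simp: r_def)
    then show ?thesis using K by (intro mult_left_mono) auto
  qed
  finally have "4 * e * r\<^sup>2 \<le> 2 * e * r\<^sup>2" using S1 by (simp add: algebra_simps)
  then show False using e r by simp
qed

context banach_fun_alg
begin

definition ideal_of :: "('a \<Rightarrow> complex) set \<Rightarrow> bool" where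
  "ideal_of I \<longleftrightarrow> I \<subseteq> A \<and> 0 \<in> I \<and> (\<forall>f\<in>I. \<forall>g\<in>I. f + g \<in> I) \<and> (\<forall>f\<in>A. \<forall>g\<in>I. f * g \<in> I)"

lemma ideal_ofD:
  assumes "ideal_of I"
  shows "I \<subseteq> A" "0 \<in> I" "f \<in> I \<Longrightarrow> g \<in> I \<Longrightarrow> f + g \<in> I" "f \<in> A \<Longrightarrow> g \<in> I \<Longrightarrow> f * g \<in> I"
    "g \<in> I \<Longrightarrow> cscale c g \<in> I" "f \<in> I \<Longrightarrow> g \<in> I \<Longrightarrow> f - g \<in> I"
proof -
  show *: "I \<subseteq> A" "0 \<in> I" "f \<in> I \<Longrightarrow> g \<in> I \<Longrightarrow> f + g \<in> I" "f \<in> A \<Longrightarrow> g \<in> I \<Longrightarrow> f * g \<in> I" for f g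
    using assms by (auto simp: ideal_of_def)
  have eq: "cscale c g = (\<lambda>x. c) * g" for c g by (simp add: fun_eq_iff)
  show **: "cscale c g \<in> I" if "g \<in> I" for c g
    unfolding eq by (rule *(4)[OF A_const that])
  have eq: "f - g = f + cscale (-1) g" by (simp add: fun_eq_iff)
  show "f - g \<in> I" if "f \<in> I" "g \<in> I"
    unfolding eq by (rule *(3)[OF that(1) **[OF that(2)]])
qed

text \<open>Zorn's lemma for the ideals that contain \<open>I\<close> but not 1: the union of a
  nonempty chain is again such an ideal.\<close>

lemma exists_maximal_ideal:
  assumes I: "ideal_of I" and one: "1 \<notin> I"
  obtains M where "ideal_of M" "1 \<notin> M" "I \<subseteq> M"
    "\<And>J. ideal_of J \<Longrightarrow> 1 \<notin> J \<Longrightarrow> M \<subseteq> J \<Longrightarrow> J = M"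
proof -
  define X where "X = {J. ideal_of J \<and> 1 \<notin> J \<and> I \<subseteq> J}"
  have "\<exists>M\<in>X. \<forall>J\<in>X. M \<subseteq> J \<longrightarrow> J = M"
  proof (rule subset_Zorn_nonempty)
    show "X \<noteq> {}" using I one by (auto simp: X_def)
    fix C assume ne: "C \<noteq> {}" and chain: "subset.chain X C"
    have C: "J \<in> X" if "J \<in> C" for J using chain that by (auto simp: subset.chain_def)
    have CI: "ideal_of J" if "J \<in> C" for J using C[OF that] by (simp add: X_def)
    have "f + g \<in> \<Union>C" if "f \<in> J" "J \<in> C" "g \<in> J'" "J' \<in> C" for f g J J'
    proof -
      have "J \<subseteq> J' \<or> J' \<subseteq> J" using chain that by (auto simp: subset.chain_def)
      then show ?thesis
        using that ideal_ofD(3)[OF CI[OF that(2)], of f g] ideal_ofD(3)[OF CI[OF that(4)], of f g] by blast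
    qed
    then have "ideal_of (\<Union>C)"
      unfolding ideal_of_def
    proof (intro conjI ballI)
      show "\<Union>C \<subseteq> A" using ideal_ofD(1)[OF CI] by blast
      show "0 \<in> \<Union>C" using ne ideal_ofD(2)[OF CI] by blast
    next
      fix f g assume "f \<in> A" "g \<in> \<Union>C"
      then show "f * g \<in> \<Union>C" using ideal_ofD(4)[OF CI] by (metis UnionE UnionI)
    qed (erule UnionE, erule UnionE, assumption)
    then show "\<Union>C \<in> X" using ne C by (auto simp: X_def)
  qed
  then obtain M where "M \<in> X" and max: "\<And>J. J \<in> X \<Longrightarrow> M \<subseteq> J \<Longrightarrow> J = M" by blast
  then have M: "ideal_of M" "1 \<notin> M" "I \<subseteq> M" by (simp_all add: X_def)
  show ?thesis
  proof (rule that[OF M])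
    fix J assume "ideal_of J" "1 \<notin> J" "M \<subseteq> J"
    with M(3) show "J = M" by (intro max) (auto simp: X_def)
  qed
qed

end

section \<open>The quotient by a maximal ideal and its norm\<close>

locale maximal_ideal_of = banach_fun_alg +
  fixes M
  assumes ideal: "ideal_of M" and one_notin: "1 \<notin> M"
    and maximal: "\<And>J. ideal_of J \<Longrightarrow> 1 \<notin> J \<Longrightarrow> M \<subseteq> J \<Longrightarrow> J = M"
begin

lemmas M_sub = ideal_ofD(1)[OF ideal] and M_zero = ideal_ofD(2)[OF ideal]
  and M_add = ideal_ofD(3)[OF ideal] and M_mult = ideal_ofD(4)[OF ideal]
  and M_cscale = ideal_ofD(5)[OF ideal] and M_diff = ideal_ofD(6)[OF ideal]

lemma M_A: "m \<in> M \<Longrightarrow> m \<in> A"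
  using M_sub by blast

lemma M_mult2: "f \<in> M \<Longrightarrow> g \<in> A \<Longrightarrow> f * g \<in> M"
  using M_mult[of g f] by (simp add: mult.commute)

text \<open>The ideal generated by \<open>M\<close> and \<open>f\<close> is larger than
  \<open>M\<close>, so by maximality it contains 1. In other words, the quotient by \<open>M\<close>
  is a field.\<close>

lemma inverse_mod:
  assumes f: "f \<in> A" "f \<notin> M"
  obtains g where "g \<in> A" "f * g - 1 \<in> M"
proof -
  define J where "J = {g * f + m | g m. g \<in> A \<and> m \<in> M}"
  have J: "g * f + m \<in> J" if "g \<in> A" "m \<in> M" for g m
    using that unfolding J_def by blast
  have "ideal_of J"
    unfolding ideal_of_def
  proof (intro conjI ballI)
    show "J \<subseteq> A" unfolding J_def using f M_A by blast
    show "0 \<in> J" using J[OF A_zero M_zero] by simp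
    fix p q assume "q \<in> J"
    then obtain g m where q: "q = g * f + m" "g \<in> A" "m \<in> M" unfolding J_def by blast
    { assume "p \<in> J"
      then obtain g' m' where p: "p = g' * f + m'" "g' \<in> A" "m' \<in> M" unfolding J_def by blast
      have "p + q = (g' + g) * f + (m' + m)" unfolding p q by (simp add: fun_eq_iff algebra_simps)
      then show "p + q \<in> J" using J[OF A_add[OF p(2) q(2)] M_add[OF p(3) q(3)]] by metis }
    { assume "p \<in> A"
      have "p * q = (p * g) * f + p * m" unfolding q by (simp add: fun_eq_iff algebra_simps)
      then show "p * q \<in> J" using J[OF A_mult[OF \<open>p \<in> A\<close> q(2)] M_mult[OF \<open>p \<in> A\<close> q(3)]] by metis }
  qed
  moreover have "M \<subseteq> J"
  proof
    fix m assume "m \<in> M"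
    from J[OF A_zero this] show "m \<in> J" by simp
  qed
  moreover have "f \<in> J" using J[OF A_one M_zero] by simp
  ultimately have "1 \<in> J" using maximal[of J] f by blast
  then obtain g m where g: "1 = g * f + m" "g \<in> A" "m \<in> M" unfolding J_def by blast
  have "f * g - 1 = cscale (-1) m" unfolding g(1) by (simp add: fun_eq_iff algebra_simps)
  then have "f * g - 1 \<in> M" using M_cscale[OF g(3)] by metis
  then show ?thesis using that g by blast
qed

text \<open>The quotient norm of the coset of \<open>f\<close>. It is handled on representatives in
  \<open>A\<close>, so identities modulo \<open>M\<close> enter through \<open>q_cong\<close>
  instead of a quotient type.\<close>

definition q :: "('a \<Rightarrow> complex) \<Rightarrow> real" where
  "q f = (INF m\<in>M. N (f + m))"

lemma q_bdd: "f \<in> A \<Longrightarrow> bdd_below ((\<lambda>m. N (f + m)) ` M)"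
  by (rule bdd_belowI2[of _ 0]) (simp only: N_nonneg A_add M_A)

lemma q_le: "f \<in> A \<Longrightarrow> m \<in> M \<Longrightarrow> q f \<le> N (f + m)"
  unfolding q_def by (rule cINF_lower[OF q_bdd])

lemma q_ge: "(\<And>m. m \<in> M \<Longrightarrow> z \<le> N (f + m)) \<Longrightarrow> z \<le> q f"
  unfolding q_def using M_zero by (intro cINF_greatest) auto

lemma q_approx:
  assumes "f \<in> A" "e > 0"
  obtains m where "m \<in> M" "N (f + m) < q f + e"
  using cINF_less_iff[of M "\<lambda>m. N (f + m)" "q f + e"] q_bdd[OF assms(1)] M_zero assms
  unfolding q_def by auto

lemma q_nonneg: "f \<in> A \<Longrightarrow> 0 \<le> q f"
  by (rule q_ge) (simp only: N_nonneg A_add M_A)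

lemma q_cong:
  assumes f: "f \<in> A" and g: "g \<in> A" and fg: "f - g \<in> M"
  shows "q f = q g"
proof (rule antisym)
  show "q f \<le> q g"
  proof (rule q_ge)
    fix m assume m: "m \<in> M"
    have "f + (m - (f - g)) = g + m" by simp
    then show "q f \<le> N (g + m)" using q_le[OF f M_diff[OF m fg]] by metis
  qed
  show "q g \<le> q f"
  proof (rule q_ge)
    fix m assume m: "m \<in> M"
    have "g + (m + (f - g)) = f + m" by simp
    then show "q g \<le> N (f + m)" using q_le[OF g M_add[OF m fg]] by metis
  qed
qed

lemma q_add:
  assumes f: "f \<in> A" and g: "g \<in> A"
  shows "q (f + g) \<le> q f + q g"
proof (rule field_le_epsilon)
  fix e :: real assume "0 < e"
  then have e: "0 < e / 2" by simp
  obtain m where m: "m \<in> M" "N (f + m) < q f + e / 2" using q_approx[OF f e] .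
  obtain n where n: "n \<in> M" "N (g + n) < q g + e / 2" using q_approx[OF g e] .
  have eq: "f + g + (m + n) = (f + m) + (g + n)" by (simp only: ac_simps)
  have "q (f + g) \<le> N (f + g + (m + n))" by (rule q_le[OF A_add[OF f g] M_add[OF m(1) n(1)]])
  also have "\<dots> \<le> N (f + m) + N (g + n)"
    unfolding eq by (intro N_triangle A_add f g M_A m n)
  finally show "q (f + g) \<le> q f + q g + e" using m(2) n(2) by linarith
qed

lemma q_mult:
  assumes f: "f \<in> A" and g: "g \<in> A"
  shows "q (f * g) \<le> q f * q g"
proof -
  have *: "q (f * g) \<le> N (f + m) * N (g + n)" if m: "m \<in> M" and n: "n \<in> M" for m n
  proof -
    have eq: "f * g + (f * n + m * (g + n)) = (f + m) * (g + n)"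
      by (simp add: fun_eq_iff algebra_simps)
    have "q (f * g) \<le> N (f * g + (f * n + m * (g + n)))"
      using m n f g by (simp only: q_le A_mult M_add M_mult M_mult2 A_add M_A)
    also have "\<dots> \<le> N (f + m) * N (g + n)"
      unfolding eq using m n f g by (simp only: N_mult A_add M_A)
    finally show ?thesis .
  qed
  \<comment> \<open>Near-optimal representatives give the bound only up to \<open>e\<close> in each
    factor; the limit at 0 from the right removes it.\<close>
  have "((\<lambda>e. (q f + e) * (q g + e)) \<longlongrightarrow> (q f + 0) * (q g + 0)) (at_right 0)"
    by (intro tendsto_intros)
  moreover have "\<forall>\<^sub>F e in at_right 0. q (f * g) \<le> (q f + e) * (q g + e)"
    unfolding eventually_at_filter
  proof (intro always_eventually allI impI)
    fix e :: real assume "e \<in> {0<..}"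
    then have e: "0 < e" by simp
    obtain m where m: "m \<in> M" "N (f + m) < q f + e" using q_approx[OF f e] .
    obtain n where n: "n \<in> M" "N (g + n) < q g + e" using q_approx[OF g e] .
    have "q (f * g) \<le> N (f + m) * N (g + n)" by (rule *[OF m(1) n(1)])
    also have "\<dots> \<le> (q f + e) * (q g + e)"
      using m n e q_nonneg[OF f] N_nonneg[OF A_add[OF g M_A[OF n(1)]]]
      by (intro mult_mono) simp_all
    finally show "q (f * g) \<le> (q f + e) * (q g + e)" .
  qed
  ultimately show ?thesis
    using tendsto_lowerbound[of _ _ "at_right (0::real)"] by fastforce
qed

lemma q_cscale:
  assumes f: "f \<in> A" shows "q (cscale c f) = cmod c * q f"
proof -
  have le: "q (cscale c f) \<le> cmod c * q f" if f: "f \<in> A" for c f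
  proof (cases "c = 0")
    case True
    have "q (cscale c f) \<le> N (cscale c f + 0)" by (rule q_le[OF A_cscale[OF f] M_zero])
    then show ?thesis using True N_cscale[OF f, of c] by simp
  next
    case False
    have "q (cscale c f) / cmod c \<le> q f"
    proof (rule q_ge)
      fix m assume m: "m \<in> M"
      have eq: "cscale c f + cscale c m = cscale c (f + m)" by (simp add: fun_eq_iff algebra_simps)
      have "q (cscale c f) \<le> N (cscale c f + cscale c m)"
        by (rule q_le[OF A_cscale[OF f] M_cscale[OF m]])
      then show "q (cscale c f) / cmod c \<le> N (f + m)"
        unfolding eq N_cscale[OF A_add[OF f M_A[OF m]]] using False by (simp add: field_simps)
    qed
    then show ?thesis using False by (simp add: field_simps)
  qed
  show ?thesis
  proof (cases "c = 0")
    case True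
    then show ?thesis using le[OF f, of c] q_nonneg[OF A_cscale[OF f], of c] by simp
  next
    case False
    have "cscale (1 / c) (cscale c f) = f" using False by (simp add: fun_eq_iff)
    then have "q f \<le> 1 / cmod c * q (cscale c f)"
      using le[OF A_cscale[OF f], of "1 / c" c] by (simp add: norm_divide)
    then show ?thesis using le[OF f, of c] False by (simp add: field_simps)
  qed
qed

text \<open>A member \<open>m\<close> of \<open>M\<close> with \<open>N (1 + m) < 1\<close> would
  make \<open>- m = 1 - (1 + m)\<close> invertible by the Neumann series, and \<open>M\<close> would
  contain 1.\<close>

lemma q_one_pos: "0 < q 1"
proof -
  have "1 \<le> q 1"
  proof (rule q_ge, rule ccontr)
    fix m assume m: "m \<in> M" and "\<not> 1 \<le> N (1 + m)"
    then have "N (1 + m) < 1" by simp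
    then obtain g where g: "g \<in> A" "(1 - (1 + m)) * g = 1"
      using neumann[OF A_add[OF A_one M_A[OF m]]] by blast
    have "(1 - (1 + m)) * g = cscale (-1) (g * m)" by (simp add: fun_eq_iff)
    with g have "1 \<in> M" using M_cscale[OF M_mult[OF g(1) m], of "-1"] by metis
    then show False using one_notin by simp
  qed
  then show ?thesis by simp
qed

end

section \<open>The Gelfand--Mazur theorem and the character of a maximal ideal\<close>

context maximal_ideal_of
begin

text \<open>If no \<open>f - c\<close> lay in \<open>M\<close>, each would have an inverse
  \<open>R c\<close> modulo \<open>M\<close>; the norms \<open>F c\<close> of these resolvents would
  satisfy the contradictory hypotheses of \<open>no_resolvent_norm\<close>.\<close>

theorem gelfand_mazur:
  assumes f: "f \<in> A"
  shows "\<exists>c. f - (\<lambda>x. c) \<in> M"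
proof (rule ccontr)
  assume none: "\<nexists>c. f - (\<lambda>x. c) \<in> M"
  have "\<exists>g. g \<in> A \<and> (f - (\<lambda>x. c)) * g - 1 \<in> M" for c
    using inverse_mod[OF A_diff[OF f A_const[of c]]] none by metis
  then obtain R where R: "\<And>c. R c \<in> A" and P: "\<And>c. (f - (\<lambda>x. c)) * R c - 1 \<in> M"
    by metis
  define F where "F c = q (R c)" for c
  \<comment> \<open>The defect in the resolvent identity
    \<open>R d - R c = (d - c) * R c * R d\<close>, which holds modulo \<open>M\<close>.\<close>
  define E where "E c d = R d - R c - cscale (d - c) (R c * R d)" for c d
  have E: "E c d \<in> M" for c d
  proof -
    have "E c d = R c * ((f - (\<lambda>x. d)) * R d - 1) - R d * ((f - (\<lambda>x. c)) * R c - 1)"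
      unfolding E_def by (simp add: fun_eq_iff algebra_simps)
    then show ?thesis using M_diff[OF M_mult[OF R P] M_mult[OF R P]] by metis
  qed
  show False
  proof (rule no_resolvent_norm[of F])
    fix c
    have "q 1 = q ((f - (\<lambda>x. c)) * R c)"
      by (rule q_cong[symmetric, OF A_mult[OF A_diff[OF f A_const] R] A_one P])
    also have "\<dots> \<le> q (f - (\<lambda>x. c)) * F c"
      unfolding F_def by (rule q_mult[OF A_diff[OF f A_const] R])
    finally have "0 < q (f - (\<lambda>x. c)) * F c" using q_one_pos by linarith
    then show "0 < F c"
      using q_nonneg[OF R[of c]] unfolding F_def by (cases "q (R c) = 0") auto
    \<comment> \<open>Modulo \<open>M\<close>, \<open>c * R c = f * R c - 1\<close>; this gives the
      decay with \<open>a = q f\<close> and \<open>b = q 1\<close>.\<close>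
    have eq: "cscale c (R c) - (f * R c + cscale (-1) 1) = cscale (-1) ((f - (\<lambda>x. c)) * R c - 1)"
      by (simp add: fun_eq_iff algebra_simps)
    have "cmod c * F c = q (cscale c (R c))"
      unfolding F_def by (rule q_cscale[symmetric, OF R])
    also have "\<dots> = q (f * R c + cscale (-1) 1)"
      by (rule q_cong) (use M_cscale[OF P, of "-1" c] in \<open>simp_all only: eq R f A_cscale A_add A_mult A_one\<close>)
    also have "\<dots> \<le> q (f * R c) + q (cscale (-1) 1)"
      by (rule q_add[OF A_mult[OF f R] A_cscale[OF A_one]])
    also have "\<dots> \<le> q f * F c + q 1"
      unfolding F_def using q_mult[OF f R[of c]] q_cscale[OF A_one, of "-1"] by simp
    finally show "cmod c * F c \<le> q f * F c + q 1" .
  next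
    have le: "F d \<le> F c + cmod (c - d) * F c * F d" for c d
    proof -
      have mem: "cscale (d - c) (R c * R d) \<in> A" by (rule A_cscale[OF A_mult[OF R R]])
      have "F d = q (R c + cscale (d - c) (R c * R d))"
        unfolding F_def
        by (rule q_cong[OF R A_add[OF R mem]]) (use E[of c d] in \<open>simp only: E_def diff_diff_eq\<close>)
      also have "\<dots> \<le> F c + q (cscale (d - c) (R c * R d))"
        unfolding F_def by (rule q_add[OF R mem])
      also have "q (cscale (d - c) (R c * R d)) \<le> cmod (c - d) * (F c * F d)"
        unfolding F_def q_cscale[OF A_mult[OF R R]] norm_minus_commute[of d c]
        by (rule mult_left_mono[OF q_mult[OF R R] norm_ge_zero])
      finally show ?thesis by (simp only: mult.assoc add_left_mono)
    qed
    fix c d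
    show "\<bar>F c - F d\<bar> \<le> cmod (c - d) * F c * F d"
      using le[of c d] le[of d c] norm_minus_commute[of c d]
      by (simp add: abs_le_iff algebra_simps)
  next
    fix c h
    define b where "b = R c"
    have b: "b \<in> A" unfolding b_def by (rule R)
    \<comment> \<open>Iterating the resolvent identity gives
      \<open>R (c + k) = b + k * b\<^sup>2 + k\<^sup>2 * b\<^sup>3 + w k\<close> modulo
      \<open>M\<close>; \<open>X k\<close> is the defect.\<close>
    define w where "w k = cscale (k ^ 3) (b * b * b * R (c + k))" for k
    define X where "X k = R (c + k) - b - cscale k (b * b) - cscale (k\<^sup>2) (b * b * b) - w k" for k
    have w: "w k \<in> A" for k unfolding w_def using b R by (simp only: A_cscale A_mult)
    have X: "X k \<in> M" for k
    proof -
      have "X k = (1 + cscale k b + cscale (k\<^sup>2) (b * b)) * E c (c + k)"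
        unfolding X_def E_def b_def[symmetric] w_def
        by (simp add: fun_eq_iff algebra_simps power2_eq_square power3_eq_cube)
      moreover have "1 + cscale k b + cscale (k\<^sup>2) (b * b) \<in> A"
        using b by (simp only: A_add A_one A_cscale A_mult)
      ultimately show ?thesis using M_mult E by metis
    qed
    have qw: "q (cscale (-1) (w k)) \<le> cmod k ^ 3 * F c ^ 3 * F (c + k)" for k
    proof -
      have "q (b * b * b * R (c + k)) \<le> q (b * b * b) * F (c + k)"
        unfolding F_def using b R by (simp only: q_mult A_mult)
      also have "q (b * b * b) \<le> q (b * b) * q b" using b by (simp only: q_mult A_mult)
      also have "q (b * b) \<le> q b * q b" using b by (simp only: q_mult)
      finally have "q (b * b * b * R (c + k)) \<le> q b * q b * q b * F (c + k)"
        using q_nonneg[OF b] q_nonneg[OF R[of "c + k"]] unfolding F_def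
        by (simp add: mult_right_mono)
      then have le: "q (b * b * b * R (c + k)) \<le> F c ^ 3 * F (c + k)"
        unfolding F_def b_def[symmetric] power3_eq_cube .
      have mem: "b * b * b * R (c + k) \<in> A" using b R by (simp only: A_mult)
      have "q (cscale (-1) (w k)) = cmod k ^ 3 * q (b * b * b * R (c + k))"
        unfolding q_cscale[OF w] unfolding w_def q_cscale[OF mem] by (simp add: norm_power)
      also have "\<dots> \<le> cmod k ^ 3 * (F c ^ 3 * F (c + k))"
        using le by (rule mult_left_mono) simp
      finally show ?thesis by (simp only: mult.assoc)
    qed
    define S where "S = R (c + h) + R (c + - h) + R (c + \<i> * h) + R (c + - (\<i> * h))"
    define W where "W = cscale (-1) (w h) + cscale (-1) (w (- h)) + cscale (-1) (w (\<i> * h))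
      + cscale (-1) (w (- (\<i> * h)))"
    have S: "S \<in> A" unfolding S_def by (simp only: A_add R)
    have W: "W \<in> A" unfolding W_def by (simp only: A_add w A_cscale)
    \<comment> \<open>Over the four directions the values of \<open>k\<close> and of
      \<open>k\<^sup>2\<close> each sum to 0, so only \<open>4 * b\<close> and the cubic remainders
      are left.\<close>
    have "X h + X (- h) + X (\<i> * h) + X (- (\<i> * h)) = S + W - cscale 4 b"
      unfolding X_def S_def W_def
      by (simp add: fun_eq_iff algebra_simps power2_eq_square)
    then have "S + W - cscale 4 b \<in> M" using M_add X by metis
    have qS: "q S \<le> F (c + h) + F (c - h) + F (c + \<i> * h) + F (c - \<i> * h)"
    proof -
      have "q S \<le> q (R (c + h)) + q (R (c + - h)) + q (R (c + \<i> * h)) + q (R (c + - (\<i> * h)))"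
        unfolding S_def by (intro order_trans[OF q_add] add_mono A_add R order_refl)
      then show ?thesis unfolding F_def by simp
    qed
    have qW: "q W \<le> cmod h ^ 3 * F c ^ 3 * (F (c + h) + F (c - h) + F (c + \<i> * h) + F (c - \<i> * h))"
    proof -
      have "q W \<le> cmod h ^ 3 * F c ^ 3 * F (c + h) + cmod (- h) ^ 3 * F c ^ 3 * F (c + - h)
          + cmod (\<i> * h) ^ 3 * F c ^ 3 * F (c + \<i> * h)
          + cmod (- (\<i> * h)) ^ 3 * F c ^ 3 * F (c + - (\<i> * h))"
        unfolding W_def by (intro order_trans[OF q_add] add_mono A_add A_cscale w qw)
      then show ?thesis by (simp add: norm_mult algebra_simps)
    qed
    have "4 * F c = q (cscale 4 b)"
      using q_cscale[OF b, of 4] by (simp add: F_def b_def)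
    also have "\<dots> = q (S + W)"
      using q_cong[OF A_add[OF S W] A_cscale[OF b] \<open>S + W - cscale 4 b \<in> M\<close>] by simp
    also have "\<dots> \<le> q S + q W" by (rule q_add[OF S W])
    finally show "4 * F c \<le> F (c + h) + F (c - h) + F (c + \<i> * h) + F (c - \<i> * h)
       + cmod h ^ 3 * F c ^ 3 * (F (c + h) + F (c - h) + F (c + \<i> * h) + F (c - \<i> * h))"
      using qS qW by linarith
  qed
qed

text \<open>Sending \<open>f\<close> to the constant congruent to it modulo \<open>M\<close> is well
  defined, as \<open>M\<close> contains no nonzero constant; uniqueness of this constant yields
  linearity and multiplicativity.\<close>

lemma ex_character: "\<exists>\<psi>. character_on A \<psi> \<and> (\<forall>f\<in>M. \<psi> f = 0)"
proof -
  obtain \<psi> where \<psi>: "\<And>f. f \<in> A \<Longrightarrow> f - (\<lambda>x. \<psi> f) \<in> M"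
    using gelfand_mazur by metis
  have uniq: "\<psi> f = c" if f: "f \<in> A" and c: "f - (\<lambda>x. c) \<in> M" for f c
  proof (rule ccontr)
    assume "\<psi> f \<noteq> c"
    then have "cscale (1 / (\<psi> f - c)) ((f - (\<lambda>x. c)) - (f - (\<lambda>x. \<psi> f))) = 1"
      by (simp add: fun_eq_iff)
    then show False
      using M_cscale[OF M_diff[OF c \<psi>[OF f]]] one_notin by metis
  qed
  have "\<psi> (f + g) = \<psi> f + \<psi> g" if f: "f \<in> A" and g: "g \<in> A" for f g
  proof (rule uniq[OF A_add[OF f g]])
    have "f + g - (\<lambda>x. \<psi> f + \<psi> g) = (f - (\<lambda>x. \<psi> f)) + (g - (\<lambda>x. \<psi> g))"
      by (simp add: fun_eq_iff)
    then show "f + g - (\<lambda>x. \<psi> f + \<psi> g) \<in> M" using M_add[OF \<psi>[OF f] \<psi>[OF g]] by metis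
  qed
  note add = this
  have scale: "\<psi> (cscale c f) = c * \<psi> f" if f: "f \<in> A" for c f
  proof (rule uniq[OF A_cscale[OF f]])
    have "cscale c f - (\<lambda>x. c * \<psi> f) = cscale c (f - (\<lambda>x. \<psi> f))"
      by (simp add: fun_eq_iff algebra_simps)
    then show "cscale c f - (\<lambda>x. c * \<psi> f) \<in> M" using M_cscale[OF \<psi>[OF f]] by metis
  qed
  have mult: "\<psi> (f * g) = \<psi> f * \<psi> g" if f: "f \<in> A" and g: "g \<in> A" for f g
  proof (rule uniq[OF A_mult[OF f g]])
    have "f * g - (\<lambda>x. \<psi> f * \<psi> g) = f * (g - (\<lambda>x. \<psi> g)) + cscale (\<psi> g) (f - (\<lambda>x. \<psi> f))"
      by (simp add: fun_eq_iff algebra_simps)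
    then show "f * g - (\<lambda>x. \<psi> f * \<psi> g) \<in> M"
      using M_add[OF M_mult[OF f \<psi>[OF g]] M_cscale[OF \<psi>[OF f]]] by metis
  qed
  have "\<psi> 1 = 1"
    using M_zero by (intro uniq[OF A_one]) (simp add: one_fun_def[symmetric])
  then have nonzero: "\<exists>f\<in>A. \<psi> f \<noteq> 0"
    using A_one by (metis zero_neq_one)
  have zero: "\<forall>f\<in>M. \<psi> f = 0"
    using M_A by (auto intro!: uniq simp: zero_fun_def[symmetric])
  show ?thesis
    unfolding character_on_def linear_functional_on_def multiplicative_on_def
    by (intro exI[of _ \<psi>] conjI ballI allI add scale mult nonzero zero)
qed

end

section \<open>Evaluation ideals and spectra\<close>

context banach_fun_alg
begin

lemma cring_fun_ring: "cring (fun_ring A)"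
proof (rule cringI)
  show "abelian_group (fun_ring A)"
  proof (rule abelian_groupI)
    fix f assume "f \<in> carrier (fun_ring A)"
    then show "\<exists>g\<in>carrier (fun_ring A). g \<oplus>\<^bsub>fun_ring A\<^esub> f = \<zero>\<^bsub>fun_ring A\<^esub>"
      by (intro bexI[of _ "- f"]) (simp_all add: fun_ring_def A_uminus)
  qed (simp_all add: fun_ring_def A_add ac_simps)
  show "comm_monoid (fun_ring A)"
    by (rule comm_monoidI) (simp_all add: fun_ring_def A_mult ac_simps)
qed (simp add: fun_ring_def distrib_right)

text \<open>If a larger ideal contains \<open>f\<close> with \<open>f x \<noteq> 0\<close>, it
  contains \<open>g = f / f x\<close> and also \<open>1 - g\<close>, which vanishes at
  \<open>x\<close>; hence it contains 1.\<close>

lemma maximalideal_evaluation: "maximalideal {f \<in> A. f x = 0} (fun_ring A)" (is "maximalideal ?K _")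
proof (rule maximalidealI)
  interpret cring "fun_ring A" by (rule cring_fun_ring)
  show "ideal ?K (fun_ring A)"
  proof (rule idealI[OF ring_axioms])
    show "subgroup ?K (add_monoid (fun_ring A))"
    proof (rule add.subgroupI)
      show "?K \<subseteq> carrier (fun_ring A)" by (auto simp: fun_ring_def)
      show "?K \<noteq> {}" using A_zero by (auto intro!: exI[of _ 0])
    next
      fix f assume f: "f \<in> ?K"
      have "\<ominus>\<^bsub>fun_ring A\<^esub> f = - f"
        using f by (intro minus_equality) (simp_all add: fun_ring_def A_uminus)
      then show "\<ominus>\<^bsub>fun_ring A\<^esub> f \<in> ?K" using f A_uminus[of f] by simp
    qed (simp add: fun_ring_def A_add)
  qed (simp_all add: fun_ring_def A_mult)
  have "1 \<notin> ?K" by simp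
  then show "carrier (fun_ring A) \<noteq> ?K" using A_one by (metis fun_ring_def partial_object.select_convs(1))
  fix J assume J: "ideal J (fun_ring A)" and sub: "?K \<subseteq> J" "J \<subseteq> carrier (fun_ring A)"
  interpret J: ideal J "fun_ring A" by (rule J)
  have JA: "f \<in> A" if "f \<in> J" for f using sub(2) that by (auto simp: fun_ring_def)
  show "J = ?K \<or> J = carrier (fun_ring A)"
  proof (rule disjCI)
    assume "J \<noteq> carrier (fun_ring A)"
    have "f x = 0" if f: "f \<in> J" for f
    proof (rule ccontr)
      assume nz: "f x \<noteq> 0"
      define g where "g = cscale (1 / f x) f"
      have "g = (\<lambda>y. 1 / f x) \<otimes>\<^bsub>fun_ring A\<^esub> f"
        by (simp add: g_def fun_ring_def fun_eq_iff)
      then have g: "g \<in> J" using J.I_l_closed[OF f, of "\<lambda>y. 1 / f x"] by (simp add: fun_ring_def A_const)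
      have "1 - g \<in> J"
        using sub(1) A_diff[OF A_one JA[OF g]] nz by (auto simp: g_def)
      from J.a_closed[OF this g] have "1 \<in> J" by (simp add: fun_ring_def)
      then have "h \<in> J" if "h \<in> A" for h
        using J.I_l_closed[of 1 h] that by (simp add: fun_ring_def)
      then show False using \<open>J \<noteq> carrier (fun_ring A)\<close> JA by (auto simp: fun_ring_def)
    qed
    then show "J = ?K" using sub(1) JA by auto
  qed
qed

text \<open>Otherwise the multiples of \<open>f\<close> form a proper ideal. Some character vanishes
  on a maximal ideal above it and is evaluation at a point by naturality; so \<open>f\<close> would
  vanish there.\<close>

lemma nonvanishing_invertible:
  assumes nat: "natural A" and f: "f \<in> A" and nz: "\<And>x. f x \<noteq> 0"
  shows "\<exists>g\<in>A. g * f = 1"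
proof (rule ccontr)
  assume none: "\<not> ?thesis"
  define I where "I = (\<lambda>g. g * f) ` A"
  have I: "g * f \<in> I" if "g \<in> A" for g using that by (simp add: I_def)
  have "ideal_of I"
    unfolding ideal_of_def
  proof (intro conjI ballI)
    show "I \<subseteq> A" unfolding I_def using f by (auto simp only: A_mult)
    show "0 \<in> I" using I[OF A_zero] by simp
    fix u v assume "v \<in> I"
    then obtain g where v: "v = g * f" "g \<in> A" by (auto simp: I_def)
    { assume "u \<in> I"
      then obtain g' where u: "u = g' * f" "g' \<in> A" by (auto simp: I_def)
      show "u + v \<in> I"
        unfolding u v distrib_right[symmetric] by (rule I[OF A_add[OF u(2) v(2)]]) }
    { assume "u \<in> A"
      show "u * v \<in> I"
        unfolding v mult.assoc[symmetric] by (rule I[OF A_mult[OF \<open>u \<in> A\<close> v(2)]]) }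
  qed
  moreover have "1 \<notin> I" using none unfolding I_def by (metis imageE)
  ultimately obtain M where M: "ideal_of M" "1 \<notin> M" "I \<subseteq> M"
    "\<And>J. ideal_of J \<Longrightarrow> 1 \<notin> J \<Longrightarrow> M \<subseteq> J \<Longrightarrow> J = M"
    using exists_maximal_ideal by blast
  interpret maximal_ideal_of A N M
    by unfold_locales (fact M)+
  obtain \<psi> where "character_on A \<psi>" and \<psi>: "\<forall>f\<in>M. \<psi> f = 0" using ex_character by blast
  then obtain x where x: "\<forall>f\<in>A. \<psi> f = f x" using nat unfolding natural_def by blast
  have "f \<in> M" using I[OF A_one] M(3) by auto
  then show False using \<psi> x f nz by metis
qed

text \<open>The inclusion that makes each value of a spectral function at \<open>f\<close> a value
  of \<open>f\<close> on the space.\<close>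

lemma spectrum_subset_range:
  assumes "natural A" and f: "f \<in> A"
  shows "spectrum A f \<subseteq> range f"
proof
  fix c assume c: "c \<in> spectrum A f"
  show "c \<in> range f"
  proof (rule ccontr)
    assume "c \<notin> range f"
    then have "(f - (\<lambda>x. c)) x \<noteq> 0" for x by auto
    then obtain g where "g \<in> A" "g * (f - (\<lambda>x. c)) = 1"
      using nonvanishing_invertible[OF assms(1) A_diff[OF f A_const]] by blast
    then have "f - (\<lambda>x. c) \<in> Units (fun_ring A)"
      using f by (auto simp: Units_def fun_ring_def mult.commute A_const intro!: bexI[of _ g])
    then show False using c by (simp add: spectrum_def)
  qed
qed

end

subsection \<open>Linear functionals below a sublinear functional\<close>

definition sublinear :: "('v::real_vector \<Rightarrow> real) \<Rightarrow> bool" where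
  "sublinear p \<longleftrightarrow> (\<forall>u v. p (u + v) \<le> p u + p v) \<and> (\<forall>t v. 0 \<le> t \<longrightarrow> p (t *\<^sub>R v) = t * p v)"

lemma sublinearD:
  assumes "sublinear p"
  shows "p (u + v) \<le> p u + p v" "0 \<le> t \<Longrightarrow> p (t *\<^sub>R v) = t * p v" "p 0 = 0" "- p (- v) \<le> p v"
proof -
  show *: "p (u + v) \<le> p u + p v" "0 \<le> t \<Longrightarrow> p (t *\<^sub>R v) = t * p v" for u v t
    using assms by (auto simp: sublinear_def)
  show 0: "p 0 = 0" using *(2)[of 0 0] by simp
  show "- p (- v) \<le> p v" using *(1)[of v "- v"] 0 by simp
qed

lemma sublinearI:
  assumes add: "\<And>u v. p (u + v) \<le> p u + p v"
    and scale: "\<And>t v. 0 < t \<Longrightarrow> p (t *\<^sub>R v) \<le> t * p v" and zero: "p 0 = 0"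
  shows "sublinear p"
  unfolding sublinear_def
proof (intro conjI allI impI add)
  fix t :: real and v assume "0 \<le> t"
  show "p (t *\<^sub>R v) = t * p v"
  proof (cases "t = 0")
    case False
    then have t: "0 < t" using \<open>0 \<le> t\<close> by simp
    have "p v \<le> inverse t * p (t *\<^sub>R v)"
      using scale[of "inverse t" "t *\<^sub>R v"] t by simp
    then have "t * p v \<le> p (t *\<^sub>R v)"
      using t by (simp add: field_simps)
    then show ?thesis using scale[OF t, of v] by simp
  qed (use zero in simp)
qed

text \<open>A linear \<open>L\<close> below the new functional satisfies
  \<open>L c \<ge> r c\<close> on \<open>C\<close>, as \<open>v = - c\<close> shows. The infimum is
  finite because \<open>r c \<le> p c \<le> p (v + c) + p (- v)\<close>. It is used with
  \<open>r = p\<close> on a ray and with \<open>r = 0\<close> on a cone.\<close>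

lemma sublinear_INF:
  fixes p :: "'v::real_vector \<Rightarrow> real"
  assumes p: "sublinear p" and zero: "0 \<in> C"
    and add: "\<And>c d. c \<in> C \<Longrightarrow> d \<in> C \<Longrightarrow> c + d \<in> C"
    and scale: "\<And>t c. 0 < t \<Longrightarrow> c \<in> C \<Longrightarrow> t *\<^sub>R c \<in> C"
    and r_add: "\<And>c d. c \<in> C \<Longrightarrow> d \<in> C \<Longrightarrow> r (c + d) = r c + (r d :: real)"
    and r_scale: "\<And>t c. 0 < t \<Longrightarrow> c \<in> C \<Longrightarrow> r (t *\<^sub>R c) = t * r c"
    and r0: "r 0 = 0"
    and r_le: "\<And>c. c \<in> C \<Longrightarrow> r c \<le> p c"
  shows "sublinear (\<lambda>v. INF c\<in>C. p (v + c) - r c)" (is "sublinear ?p")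
    and "c \<in> C \<Longrightarrow> (INF c\<in>C. p (v + c) - r c) \<le> p (v + c) - r c"
proof -
  have bdd: "bdd_below ((\<lambda>c. p (v + c) - r c) ` C)" for v
  proof (rule bdd_belowI2[of _ "- p (- v)"])
    fix c assume "c \<in> C"
    then show "- p (- v) \<le> p (v + c) - r c"
      using sublinearD(1)[OF p, of "v + c" "- v"] r_le[of c] by simp
  qed
  show lower: "?p v \<le> p (v + c) - r c" if "c \<in> C" for c v
    by (rule cINF_lower[OF bdd that])
  have greatest: "z \<le> ?p v" if "\<And>c. c \<in> C \<Longrightarrow> z \<le> p (v + c) - r c" for z v
    using zero that by (intro cINF_greatest) auto
  show "sublinear ?p"
  proof (rule sublinearI)
    fix u v
    have *: "?p (u + v) \<le> (p (u + c) - r c) + (p (v + d) - r d)" if "c \<in> C" "d \<in> C" for c d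
      using lower[OF add[OF that], of "u + v"] sublinearD(1)[OF p, of "u + c" "v + d"] r_add[OF that]
      by (simp add: algebra_simps)
    have "?p (u + v) - (p (u + c) - r c) \<le> ?p v" if "c \<in> C" for c
      by (rule greatest) (use *[OF that] in \<open>simp add: algebra_simps\<close>)
    then have "?p (u + v) - ?p v \<le> p (u + c) - r c" if "c \<in> C" for c
      using that by (simp add: algebra_simps)
    then have "?p (u + v) - ?p v \<le> ?p u" by (rule greatest)
    then show "?p (u + v) \<le> ?p u + ?p v" by simp
  next
    fix t :: real and v assume t: "0 < t"
    have "?p (t *\<^sub>R v) / t \<le> p (v + c) - r c" if "c \<in> C" for c
    proof -
      have "?p (t *\<^sub>R v) \<le> p (t *\<^sub>R (v + c)) - r (t *\<^sub>R c)"
        using lower[OF scale[OF t that], of "t *\<^sub>R v"] by (simp only: scaleR_add_right)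
      also have "\<dots> = (p (v + c) - r c) * t"
        using r_scale[OF t that] t sublinearD(2)[OF p, of t "v + c"]
        by (simp only: less_imp_le) (simp add: algebra_simps)
      finally show ?thesis using t by (simp only: pos_divide_le_eq)
    qed
    then have "?p (t *\<^sub>R v) / t \<le> ?p v" by (rule greatest)
    then show "?p (t *\<^sub>R v) \<le> t * ?p v"
      using t by (simp add: pos_divide_le_eq mult.commute)
  next
    have "0 \<le> ?p 0" by (rule greatest) (use r_le in simp)
    moreover have "?p 0 \<le> 0" using lower[OF zero, of 0] r0 sublinearD(3)[OF p] by simp
    ultimately show "?p 0 = 0" by simp
  qed
qed

text \<open>Lowering \<open>p\<close> along the ray of \<open>v\<close> gives a sublinear
  \<open>q \<le> p\<close> with \<open>q (- v) \<le> - p v\<close>. Minimality turns this into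
  oddness of \<open>p\<close>, and an odd sublinear functional is linear.\<close>

lemma minimal_sublinear_linear:
  fixes p :: "'v::real_vector \<Rightarrow> real"
  assumes p: "sublinear p" and min: "\<And>q. sublinear q \<Longrightarrow> q \<le> p \<Longrightarrow> q = p"
  shows "linear p"
proof -
  have neg: "p (- v) = - p v" for v
  proof -
    define C where "C = (\<lambda>t. t *\<^sub>R v) ` {0..}"
    define q where "q = (\<lambda>u. INF c\<in>C. p (u + c) - p c)"
    have C: "t *\<^sub>R v \<in> C" if "0 \<le> t" for t using that unfolding C_def by blast
    have CE: "\<exists>t\<ge>0. c = t *\<^sub>R v" if "c \<in> C" for c using that by (auto simp: C_def)
    have z: "0 \<in> C" using C[of 0] by simp
    have a: "c + d \<in> C" if "c \<in> C" "d \<in> C" for c d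
      using CE[OF that(1)] CE[OF that(2)] C by (auto simp: scaleR_add_left[symmetric])
    have s: "t *\<^sub>R c \<in> C" if "0 < t" "c \<in> C" for t c
      using CE[OF that(2)] C that(1) by auto
    have ra: "p (c + d) = p c + p d" if cd: "c \<in> C" "d \<in> C" for c d
    proof -
      obtain s t where st: "0 \<le> s" "c = s *\<^sub>R v" "0 \<le> t" "d = t *\<^sub>R v"
        using CE[OF cd(1)] CE[OF cd(2)] by blast
      then have "c + d = (s + t) *\<^sub>R v" by (simp add: scaleR_add_left)
      moreover have "0 \<le> s + t" using st by simp
      ultimately show ?thesis
        using st by (simp add: sublinearD(2)[OF p] distrib_right)
    qed
    have rs: "p (t *\<^sub>R c) = t * p c" if "0 < t" "c \<in> C" for t c
      using sublinearD(2)[OF p, of t c] that(1) by simp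
    have q_le: "q u \<le> p (u + c) - p c" if "c \<in> C" for u c
      unfolding q_def by (rule sublinear_INF(2)[OF p z a s ra rs sublinearD(3)[OF p] order_refl that])
      have "sublinear q" 
      unfolding q_def by (rule sublinear_INF(1)[OF p z a s ra rs sublinearD(3)[OF p] order_refl])
    moreover have "q \<le> p"
    proof (rule le_funI)
      fix u show "q u \<le> p u"
        using q_le[OF z, of u] sublinearD(3)[OF p] by simp
    qed
    ultimately have "q = p" by (rule min)
    moreover have "q (- v) \<le> - p v"
      using q_le[OF C[of 1], of "- v"] sublinearD(3)[OF p] by simp
    ultimately have "p (- v) \<le> - p v" by simp
    then show ?thesis using sublinearD(4)[OF p, of v] by simp
  qed
  show ?thesis
  proof (rule linearI)
    fix u v
    have "p u \<le> p (u + v) + p (- v)" using sublinearD(1)[OF p, of "u + v" "- v"] by simp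
    then show "p (u + v) = p u + p v" using neg[of v] sublinearD(1)[OF p, of u v] by simp
  next
    fix t v
    show "p (t *\<^sub>R v) = t *\<^sub>R p v"
    proof (cases "0 \<le> t")
      case False
      then have "p ((- t) *\<^sub>R v) = (- t) * p v" by (intro sublinearD(2)[OF p]) simp
      then show ?thesis using neg[of "t *\<^sub>R v"] by simp
    qed (simp add: sublinearD(2)[OF p])
  qed
qed

text \<open>The Hahn--Banach theorem through Zorn's lemma: the pointwise infimum of a chain is
  finite, being at least \<open>- P (- v)\<close>, and a minimal sublinear functional is
  linear.\<close>

lemma linear_le_sublinear:
  fixes P :: "'v::real_vector \<Rightarrow> real"
  assumes P: "sublinear P"
  obtains L where "linear L" "\<And>v. L v \<le> P v"
proof -
  define X where "X = {p. sublinear p \<and> p \<le> P}"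
  have PX: "P \<in> X" using P by (simp add: X_def)
  have "\<exists>m\<in>X. \<forall>a\<in>X. m \<ge> a \<longrightarrow> a = m"
  proof (rule predicate_Zorn)
    show "partial_order_on X (relation_of (\<ge>) X)"
      by (rule partial_order_on_relation_ofI) auto
    fix C assume C: "C \<in> Chains (relation_of (\<ge>) X)"
    have CX: "p \<in> X" if "p \<in> C" for p
      using C that unfolding Chains_def relation_of_def by auto
    have tot: "p \<le> p' \<or> p' \<le> p" if "p \<in> C" "p' \<in> C" for p p'
      using C that unfolding Chains_def relation_of_def by auto
    show "\<exists>u\<in>X. \<forall>a\<in>C. u \<le> a"
    proof (cases "C = {}")
      case True
      then show ?thesis using PX by blast
    next
      case False
      have sub: "sublinear p" and leP: "p v \<le> P v" if "p \<in> C" for p v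
        using CX[OF that] by (auto simp: X_def le_fun_def)
      define u where "u v = (INF p\<in>C. p v)" for v
      have bdd: "bdd_below ((\<lambda>p. p v) ` C)" for v
      proof (rule bdd_belowI2[of _ "- P (- v)"])
        fix p assume "p \<in> C"
        then show "- P (- v) \<le> p v" using sublinearD(4)[OF sub, of p v] leP[of p "- v"] by simp
      qed
      have lower: "u v \<le> p v" if "p \<in> C" for p v
        unfolding u_def by (rule cINF_lower[OF bdd that])
      have greatest: "z \<le> u v" if "\<And>p. p \<in> C \<Longrightarrow> z \<le> p v" for z v
        unfolding u_def using False that by (intro cINF_greatest) auto
      have "sublinear u"
      proof (rule sublinearI)
        fix v w
        \<comment> \<open>The infima at \<open>v\<close> and \<open>w\<close> may be approached by
          different members of the chain; the smaller of the two, \<open>r\<close>, serves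
          both.\<close>
        have *: "u (v + w) \<le> p v + p' w" if pp: "p \<in> C" "p' \<in> C" for p p'
        proof -
          obtain r where r: "r \<in> C" "r \<le> p" "r \<le> p'" using tot[OF pp] pp by blast
          have "u (v + w) \<le> r v + r w"
            using lower[OF r(1), of "v + w"] sublinearD(1)[OF sub[OF r(1)], of v w] by simp
          also have "\<dots> \<le> p v + p' w" using r(2,3) by (intro add_mono) (auto simp: le_fun_def)
          finally show ?thesis .
        qed
        have "u (v + w) - p v \<le> u w" if "p \<in> C" for p
          by (rule greatest) (use *[OF that] in \<open>simp add: algebra_simps\<close>)
        then have "u (v + w) - u w \<le> p v" if "p \<in> C" for p using that by (simp add: algebra_simps)
        then have "u (v + w) - u w \<le> u v" by (rule greatest)
        then show "u (v + w) \<le> u v + u w" by simp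
      next
        fix t :: real and v assume t: "0 < t"
        have "u (t *\<^sub>R v) / t \<le> p v" if "p \<in> C" for p
          using lower[OF that, of "t *\<^sub>R v"] sublinearD(2)[OF sub[OF that], of t v] t
          by (simp add: pos_divide_le_eq mult.commute)
        then have "u (t *\<^sub>R v) / t \<le> u v" by (rule greatest)
        then show "u (t *\<^sub>R v) \<le> t * u v" using t by (simp add: pos_divide_le_eq mult.commute)
      next
        obtain p where "p \<in> C" using False by blast
        then have "u 0 \<le> 0" using lower[of p 0] sublinearD(3)[OF sub[of p]] by simp
        moreover have "0 \<le> u 0"
          by (rule greatest) (use sublinearD(3)[OF sub] in \<open>metis order_refl\<close>)
        ultimately show "u 0 = 0" by simp
      qed
      moreover have "u \<le> P"
      proof (rule le_funI)
        fix v
        obtain p where "p \<in> C" using False by blast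
        then show "u v \<le> P v" using lower[of p v] leP[of p v] by simp
      qed
      ultimately have "u \<in> X" by (simp add: X_def)
      then show ?thesis using lower by (auto simp: le_fun_def)
    qed
  qed
  then obtain p where p: "p \<in> X" and min: "\<And>q. q \<in> X \<Longrightarrow> q \<le> p \<Longrightarrow> q = p" by blast
  have "linear p"
    by (rule minimal_sublinear_linear) (use p min in \<open>auto simp: X_def\<close>)
  moreover have "p v \<le> P v" for v using p by (simp add: X_def le_fun_def)
  ultimately show ?thesis by (rule that)
qed

text \<open>Minimizing \<open>P (v + c)\<close> over \<open>C\<close> first forces
  \<open>L (- c) \<le> P 0 = 0\<close>; nonnegativity of \<open>P\<close> on \<open>C\<close> keeps
  the infimum finite.\<close>

lemma linear_nonneg_on_cone:
  fixes P :: "'v::real_vector \<Rightarrow> real"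
  assumes P: "sublinear P" and C: "0 \<in> C" "\<And>c d. c \<in> C \<Longrightarrow> d \<in> C \<Longrightarrow> c + d \<in> C"
    "\<And>t c. 0 < t \<Longrightarrow> c \<in> C \<Longrightarrow> t *\<^sub>R c \<in> C" and nonneg: "\<And>c. c \<in> C \<Longrightarrow> 0 \<le> P c"
  obtains L where "linear L" "\<And>v. L v \<le> P v" "\<And>c. c \<in> C \<Longrightarrow> 0 \<le> L c"
proof -
  define p where "p v = (INF c\<in>C. P (v + c) - 0)" for v
  have "sublinear p"
    unfolding p_def by (rule sublinear_INF(1)[OF P C]) (simp_all add: nonneg)
  then obtain L where L: "linear L" "\<And>v. L v \<le> p v"
    using linear_le_sublinear by blast
  have p_le: "p v \<le> P (v + c)" if "c \<in> C" for v c
    using sublinear_INF(2)[OF P C, where r = "\<lambda>_. 0" and c = c and v = v] nonneg that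
    by (simp add: p_def)
  show ?thesis
  proof (rule that[OF L(1)])
    show "L v \<le> P v" for v
      using L(2)[of v] p_le[OF C(1), of v] by simp
    fix c assume "c \<in> C"
    then have "L (- c) \<le> 0"
      using L(2)[of "- c"] p_le[of c "- c"] sublinearD(3)[OF P] by simp
    then show "0 \<le> L c" using linear_neg[OF L(1)] by simp
  qed
qed

subsection \<open>The Choquet boundary\<close>

text \<open>Integration against a probability measure, expressed as a normalized positive linear
  functional on the real continuous functions; its values elsewhere are arbitrary.\<close>

locale positive_functional =
  fixes \<Lambda> :: "('a::topological_space \<Rightarrow> real) \<Rightarrow> real"
  assumes compact: "compact (UNIV :: 'a set)"
    and add: "continuous_on UNIV u \<Longrightarrow> continuous_on UNIV v \<Longrightarrow> \<Lambda> (\<lambda>y. u y + v y) = \<Lambda> u + \<Lambda> v"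
    and scale: "continuous_on UNIV u \<Longrightarrow> \<Lambda> (\<lambda>y. c * u y) = c * \<Lambda> u"
    and mono: "continuous_on UNIV u \<Longrightarrow> continuous_on UNIV v \<Longrightarrow> (\<And>y. u y \<le> v y) \<Longrightarrow> \<Lambda> u \<le> \<Lambda> v"
    and one: "\<Lambda> (\<lambda>_. 1) = 1"
begin

lemma diff: "continuous_on UNIV u \<Longrightarrow> continuous_on UNIV v \<Longrightarrow> \<Lambda> (\<lambda>y. u y - v y) = \<Lambda> u - \<Lambda> v"
  using add[of u "\<lambda>y. (-1) * v y"] scale[of v "-1"] by (simp add: continuous_on_minus)

lemma const: "\<Lambda> (\<lambda>_. c) = c"
  using scale[of "\<lambda>_. 1" c] one by simp

lemma nonneg: "continuous_on UNIV u \<Longrightarrow> (\<And>y. 0 \<le> u y) \<Longrightarrow> 0 \<le> \<Lambda> u"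
  using mono[of "\<lambda>_. 0" u] const[of 0] by simp

text \<open>The integral of the complex function \<open>f\<close> against the measure with density
  \<open>h\<close>.\<close>

definition complexified :: "('a \<Rightarrow> real) \<Rightarrow> ('a \<Rightarrow> complex) \<Rightarrow> complex" where
  "complexified h f = Complex (\<Lambda> (\<lambda>y. h y * Re (f y))) (\<Lambda> (\<lambda>y. h y * Im (f y)))"

lemma complexified_add:
  assumes "continuous_on UNIV h" "continuous_on UNIV f" "continuous_on UNIV g"
  shows "complexified h (\<lambda>y. f y + g y) = complexified h f + complexified h g"
  unfolding complexified_def using assms
  by (simp add: complex_eq_iff distrib_left add continuous_on_mult continuous_on_Re continuous_on_Im)

lemma complexified_cscale:
  assumes h: "continuous_on UNIV h" and f: "continuous_on UNIV f"
  shows "complexified h (\<lambda>y. c * f y) = c * complexified h f"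
proof -
  have cts: "continuous_on UNIV (\<lambda>y. h y * Re (f y))" "continuous_on UNIV (\<lambda>y. h y * Im (f y))"
    using h f by (auto intro!: continuous_intros)
  have "\<Lambda> (\<lambda>y. h y * Re (c * f y)) = \<Lambda> (\<lambda>y. Re c * (h y * Re (f y)) - Im c * (h y * Im (f y)))"
    by (simp add: algebra_simps)
  also have "\<dots> = Re c * \<Lambda> (\<lambda>y. h y * Re (f y)) - Im c * \<Lambda> (\<lambda>y. h y * Im (f y))"
    using cts by (simp add: diff scale continuous_on_mult_left)
  moreover have "\<Lambda> (\<lambda>y. h y * Im (c * f y)) = \<Lambda> (\<lambda>y. Re c * (h y * Im (f y)) + Im c * (h y * Re (f y)))"
    by (simp add: algebra_simps)
  moreover have "\<dots> = Re c * \<Lambda> (\<lambda>y. h y * Im (f y)) + Im c * \<Lambda> (\<lambda>y. h y * Re (f y))"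
    using cts by (simp add: add scale continuous_on_mult_left)
  ultimately show ?thesis by (simp add: complexified_def complex_eq_iff)
qed

lemma complexified_add_weight:
  assumes "continuous_on UNIV h" "continuous_on UNIV k" "continuous_on UNIV f"
  shows "complexified (\<lambda>y. h y + k y) f = complexified h f + complexified k f"
  unfolding complexified_def using assms
  by (simp add: complex_eq_iff distrib_right add continuous_on_mult continuous_on_Re continuous_on_Im)

lemma complexified_scale_weight:
  assumes "continuous_on UNIV h" "continuous_on UNIV f"
  shows "complexified (\<lambda>y. c * h y) f = of_real c * complexified h f"
  unfolding complexified_def using assms
  by (simp add: complex_eq_iff mult.assoc scale continuous_on_mult continuous_on_Re continuous_on_Im)

lemma cmod_complexified_le:
  assumes h: "continuous_on UNIV h" "\<And>y. 0 \<le> h y" and f: "continuous_on UNIV f"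
    and le: "\<And>y. cmod (f y) \<le> B"
  shows "cmod (complexified h f) \<le> B * \<Lambda> h"
proof (cases "complexified h f = 0")
  case True
  have "0 \<le> B" using le[of undefined] norm_ge_zero order_trans by blast
  then show ?thesis using True nonneg[OF h] by simp
next
  case False
  \<comment> \<open>The rotation \<open>z\<close> makes the value real and nonnegative, so it is an
    integral of real parts and monotonicity applies.\<close>
  define z where "z = cnj (complexified h f) / cmod (complexified h f)"
  have z: "cmod z = 1" using False by (simp add: z_def norm_divide)
  have cts: "continuous_on UNIV (\<lambda>y. h y * Re (z * f y))"
    using h f by (auto intro!: continuous_intros)
  have "z * complexified h f = cmod (complexified h f)"
    using False complex_norm_square[of "complexified h f"] by (simp add: z_def power2_eq_square divide_eq_eq mult.commute)
  then have "cmod (complexified h f) = Re (complexified h (\<lambda>y. z * f y))"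
    using complexified_cscale[OF h(1) f, of z] by simp
  also have "\<dots> = \<Lambda> (\<lambda>y. h y * Re (z * f y))" by (simp add: complexified_def)
  also have "\<dots> \<le> \<Lambda> (\<lambda>y. B * h y)"
  proof (rule mono[OF cts])
    show "continuous_on UNIV (\<lambda>y. B * h y)" using h by (auto intro!: continuous_intros)
    fix y
    have "Re (z * f y) \<le> cmod (z * f y)" by (rule complex_Re_le_cmod)
    also have "\<dots> \<le> B" using le[of y] by (simp add: norm_mult z)
    finally have "h y * Re (z * f y) \<le> h y * B" using h(2) by (rule mult_left_mono)
    then show "h y * Re (z * f y) \<le> B * h y" by (simp add: mult.commute)
  qed
  also have "\<dots> = B * \<Lambda> h" using h by (simp add: scale)
  finally show ?thesis .
qed

lemma bounded: "continuous_on UNIV u \<Longrightarrow> \<exists>B>0. \<forall>y. \<bar>u y\<bar> \<le> B" for u :: "'a \<Rightarrow> real"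
  using compact_imp_bounded[OF compact_continuous_image[OF _ compact], of u]
  by (auto simp: bounded_pos)

end

section \<open>Representing functionals and extremality\<close>

locale compact_banach_fun_alg = banach_fun_alg A N
  for A :: "('a::topological_space \<Rightarrow> complex) set" and N +
  assumes compact_space: "compact (UNIV :: 'a set)"
begin

lemma cmod_le_sup_norm: "f \<in> A \<Longrightarrow> cmod (f y) \<le> sup_norm f"
  unfolding sup_norm_def by (rule cSUP_upper) (auto intro!: bdd_aboveI2[of _ _ "N f"] cmod_le_N)

text \<open>Hahn--Banach separation for the supremum and the cone of all
  \<open>t * w + Re g - Re (g x)\<close>, on which \<open>cone\<close> makes the supremum
  nonnegative. Lying below the supremum makes the functional positive with mass 1; the choice
  \<open>t = 1\<close>, \<open>g = 0\<close> gives \<open>0 \<le> \<Lambda> w\<close>, and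
  \<open>t = 0\<close> with \<open>g\<close> and \<open>- g\<close> gives the representation of
  \<open>x\<close>.\<close>

lemma ex_representing_functional:
  assumes w: "continuous_on UNIV w"
    and cone: "\<And>t g. 0 \<le> t \<Longrightarrow> g \<in> A \<Longrightarrow> \<exists>y. Re (g x) \<le> t * w y + Re (g y)"
  obtains \<Lambda> where "positive_functional \<Lambda>" "0 \<le> \<Lambda> w" "\<And>f. f \<in> A \<Longrightarrow> \<Lambda> (\<lambda>y. Re (f y)) = Re (f x)"
proof -
  define P where "P h = (SUP y. apply_bcontfun h y)" for h :: "'a \<Rightarrow>\<^sub>C real"
  have bdd: "bdd_above (range (apply_bcontfun h))" for h :: "'a \<Rightarrow>\<^sub>C real"
    using norm_bounded[of h] by (intro bdd_aboveI2[of _ _ "norm h"]) (simp add: abs_le_iff)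
  have P_ge: "apply_bcontfun h y \<le> P h" for h y
    unfolding P_def by (rule cSUP_upper[OF UNIV_I bdd])
  have P_le: "P h \<le> z" if "\<And>y. apply_bcontfun h y \<le> z" for h z
    unfolding P_def using that by (intro cSUP_least) auto
  have "sublinear P"
  proof (rule sublinearI)
    show "P (u + v) \<le> P u + P v" for u v
      by (rule P_le) (auto intro!: add_mono P_ge)
    show "P (t *\<^sub>R v) \<le> t * P v" if "0 < t" for t v
      by (rule P_le) (use that in \<open>auto intro!: mult_left_mono P_ge\<close>)
    show "P 0 = 0" by (simp add: P_def)
  qed
  \<comment> \<open>Compactness lets every continuous function become a bounded one, in a type that
    is a real vector space as \<open>linear\<close> demands.\<close>
  define b where "b u = Bcontfun u" for u :: "'a \<Rightarrow> real"
  have b: "apply_bcontfun (b u) = u" if "continuous_on UNIV u" for u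
    unfolding b_def using that compact_imp_bounded[OF compact_continuous_image[OF that compact_space]]
    by (intro Bcontfun_inverse) (simp add: bcontfun_def)
  have cRe: "continuous_on UNIV (\<lambda>y. Re (g y))" if "g \<in> A" for g
    using A_continuous[OF that] by (rule continuous_on_Re)
  define k where "k t g = b (\<lambda>y. t * w y + Re (g y) - Re (g x))" for t g
  have k: "apply_bcontfun (k t g) y = t * w y + Re (g y) - Re (g x)" if "g \<in> A" for t g y
    unfolding k_def by (subst b) (use cRe[OF that] w in \<open>auto intro!: continuous_intros\<close>)
  define C where "C = {k t g | t g. 0 \<le> t \<and> g \<in> A}"
  have C: "k t g \<in> C" if "0 \<le> t" "g \<in> A" for t g using that unfolding C_def by blast
  have CE: "\<exists>t g. 0 \<le> t \<and> g \<in> A \<and> c = k t g" if "c \<in> C" for c using that unfolding C_def by blast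
  have "0 = k 0 0" by (rule bcontfun_eqI) (simp add: k)
  then have C0: "0 \<in> C" using C[OF order_refl A_zero] by metis
  have Cadd: "c + d \<in> C" if c: "c \<in> C" and d: "d \<in> C" for c d
  proof -
    obtain t g where 1: "0 \<le> t" "g \<in> A" "c = k t g" using CE[OF c] by blast
    obtain s h where 2: "0 \<le> s" "h \<in> A" "d = k s h" using CE[OF d] by blast
    have "c + d = k (t + s) (g + h)"
      by (rule bcontfun_eqI) (simp add: k 1 2 A_add algebra_simps)
    then show ?thesis using C[OF add_nonneg_nonneg[OF 1(1) 2(1)] A_add[OF 1(2) 2(2)]] by metis
  qed
  have Cscale: "r *\<^sub>R c \<in> C" if r: "0 < r" and c: "c \<in> C" for r c
  proof -
    obtain t g where 1: "0 \<le> t" "g \<in> A" "c = k t g" using CE[OF c] by blast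
    have "r *\<^sub>R c = k (r * t) (cscale (of_real r) g)"
      by (rule bcontfun_eqI) (simp add: k 1 A_cscale algebra_simps)
    then show ?thesis using C[OF mult_nonneg_nonneg[OF less_imp_le[OF r] 1(1)] A_cscale[OF 1(2)]] by metis
  qed
  have CP: "0 \<le> P c" if c: "c \<in> C" for c
  proof -
    obtain t g where 1: "0 \<le> t" "g \<in> A" "c = k t g" using CE[OF c] by blast
    obtain y where "Re (g x) \<le> t * w y + Re (g y)" using cone[OF 1(1,2)] by blast
    then have "0 \<le> apply_bcontfun c y" by (simp add: 1 k)
    then show ?thesis using P_ge[of c y] by simp
  qed
  obtain L where L: "linear L" and LP: "\<And>v. L v \<le> P v" and LC: "\<And>c. c \<in> C \<Longrightarrow> 0 \<le> L c"
    using linear_nonneg_on_cone[OF \<open>sublinear P\<close> C0 Cadd Cscale CP] by blast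
  define \<Lambda> where "\<Lambda> u = L (b u)" for u
  have le_const: "\<Lambda> u \<le> z" if "continuous_on UNIV u" "\<And>y. u y \<le> z" for u z
    unfolding \<Lambda>_def using LP[of "b u"] P_le[of "b u" z] that by (simp add: b)
  have add: "\<Lambda> (\<lambda>y. u y + v y) = \<Lambda> u + \<Lambda> v" if u: "continuous_on UNIV u" and v: "continuous_on UNIV v" for u v
  proof -
    have "b (\<lambda>y. u y + v y) = b u + b v"
      by (rule bcontfun_eqI) (simp add: b u v continuous_on_add)
    then show ?thesis unfolding \<Lambda>_def using linear_add[OF L] by simp
  qed
  have scale: "\<Lambda> (\<lambda>y. c * u y) = c * \<Lambda> u" if u: "continuous_on UNIV u" for c u
  proof -
    have "b (\<lambda>y. c * u y) = c *\<^sub>R b u"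
      by (rule bcontfun_eqI) (simp add: b u continuous_on_mult_left)
    then show ?thesis unfolding \<Lambda>_def using linear_scale[OF L] by simp
  qed
  have diff: "\<Lambda> (\<lambda>y. u y - v y) = \<Lambda> u - \<Lambda> v" if "continuous_on UNIV u" "continuous_on UNIV v" for u v
    using add[of u "\<lambda>y. (-1) * v y"] scale[of v "-1"] that by (simp add: continuous_on_minus)
  have one: "\<Lambda> (\<lambda>_. 1) = 1"
    using le_const[of "\<lambda>_. 1" 1] le_const[of "\<lambda>_. (-1) * 1" "-1"] scale[of "\<lambda>_. 1" "-1"] by simp
  have pos: "positive_functional \<Lambda>"
  proof (unfold_locales)
    show "compact (UNIV :: 'a set)" by (rule compact_space)
    fix u v :: "'a \<Rightarrow> real" assume uv: "continuous_on UNIV u" "continuous_on UNIV v"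
    show "\<Lambda> u \<le> \<Lambda> v" if "\<And>y. u y \<le> v y"
      using le_const[of "\<lambda>y. u y - v y" 0] diff[OF uv] uv that by (simp add: continuous_on_diff)
  qed (fact add scale one)+
  then interpret positive_functional \<Lambda> .
  show ?thesis
  proof (rule that[OF pos])
    have "b w = k 1 0" by (rule bcontfun_eqI) (simp add: b w k)
    then show "0 \<le> \<Lambda> w" unfolding \<Lambda>_def using LC[OF C[of 1 0]] by simp
    have ge: "Re (g x) \<le> \<Lambda> (\<lambda>y. Re (g y))" if g: "g \<in> A" for g
    proof -
      have "0 \<le> \<Lambda> (\<lambda>y. Re (g y) - Re (g x))"
        using LC[OF C[OF order_refl g]] unfolding \<Lambda>_def k_def by simp
      also have "\<dots> = \<Lambda> (\<lambda>y. Re (g y)) - Re (g x)"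
        using diff[OF cRe[OF g] continuous_on_const] const by simp
      finally show ?thesis by simp
    qed
    fix f assume f: "f \<in> A"
    show "\<Lambda> (\<lambda>y. Re (f y)) = Re (f x)"
    proof (rule antisym)
      have "Re (cscale (-1) f x) \<le> \<Lambda> (\<lambda>y. Re (cscale (-1) f y))" by (rule ge[OF A_cscale[OF f]])
      also have "\<dots> = - \<Lambda> (\<lambda>y. Re (f y))" using scale[OF cRe[OF f], of "-1"] by simp
      finally show "\<Lambda> (\<lambda>y. Re (f y)) \<le> Re (f x)" by simp
    qed (rule ge[OF f])
  qed
qed

text \<open>The weights \<open>h\<close> and \<open>1 - h\<close> split evaluation at
  \<open>x\<close> into a convex combination of two members of the dual ball, with coefficients
  \<open>\<Lambda> h\<close> and \<open>1 - \<Lambda> h\<close>. Extremality makes both equal to the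
  evaluation.\<close>

lemma choquet_extreme:
  assumes x: "x \<in> choquet_boundary A" and pos: "positive_functional \<Lambda>"
    and rep: "\<And>f. f \<in> A \<Longrightarrow> \<Lambda> (\<lambda>y. Re (f y)) = Re (f x)"
    and h: "continuous_on UNIV h" "\<And>y. 0 \<le> h y" "\<And>y. h y \<le> 1" and f: "f \<in> A"
  shows "positive_functional.complexified \<Lambda> h f = of_real (\<Lambda> h) * f x"
proof -
  interpret positive_functional \<Lambda> by (rule pos)
  have one_weight: "complexified (\<lambda>_. 1) f = f x" if f: "f \<in> A" for f
  proof -
    have "\<Lambda> (\<lambda>y. Im (f y)) = \<Lambda> (\<lambda>y. Re (cscale (- \<i>) f y))" by simp
    also have "\<dots> = Im (f x)" using rep[OF A_cscale[OF f, of "- \<i>"]] by simp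
    finally show ?thesis using rep[OF f] by (simp add: complexified_def complex_eq_iff)
  qed
  have c1: "continuous_on UNIV (\<lambda>y. 1 - h y)" using h by (auto intro!: continuous_intros)
  have split: "complexified h f + complexified (\<lambda>y. 1 - h y) f = f x" if f: "f \<in> A" for f
    using complexified_add_weight[OF h(1) c1 A_continuous[OF f]] one_weight[OF f] by simp
  have l1: "\<Lambda> (\<lambda>y. 1 - h y) = 1 - \<Lambda> h"
    using diff[OF continuous_on_const h(1), of 1] const[of 1] by simp
  \<comment> \<open>A weight of integral 0 contributes nothing; this settles the cases
    \<open>\<Lambda> h = 0\<close> and \<open>\<Lambda> h = 1\<close>, in which one of the two
    weights cannot be normalized.\<close>
  have null: "complexified k f = 0" if "continuous_on UNIV k" "\<And>y. 0 \<le> k y" "\<Lambda> k = 0" for k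
    using cmod_complexified_le[OF that(1,2) A_continuous[OF f] cmod_le_sup_norm[OF f]] that(3) by simp
  have h01: "0 \<le> \<Lambda> h" "\<Lambda> h \<le> 1"
    using nonneg[OF h(1,2)] mono[OF h(1) continuous_on_const h(3)] const[of 1] by auto
  consider "\<Lambda> h = 0" | "\<Lambda> h = 1" | "0 < \<Lambda> h" "\<Lambda> h < 1" using h01 by linarith
  then show ?thesis
  proof cases
    case 1
    then show ?thesis using null[OF h(1,2)] by simp
  next
    case 2
    then have "complexified (\<lambda>y. 1 - h y) f = 0" using h(3) l1 by (intro null c1) auto
    then show ?thesis using split[OF f] 2 by simp
  next
    case 3
    define \<psi> where "\<psi> k = (\<lambda>f\<in>A. complexified k f / of_real (\<Lambda> k))" for k
    have ball: "\<psi> k \<in> dual_ball A"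
      if k: "continuous_on UNIV k" "\<And>y. 0 \<le> k y" "0 < \<Lambda> k" for k
    proof -
      have "linear_functional_on A (\<psi> k)"
        unfolding linear_functional_on_def
      proof (intro conjI ballI allI)
        fix f g assume fg: "f \<in> A" "g \<in> A"
        have "complexified k (f + g) = complexified k f + complexified k g"
          unfolding plus_fun_def by (rule complexified_add[OF k(1) A_continuous[OF fg(1)] A_continuous[OF fg(2)]])
        then show "\<psi> k (f + g) = \<psi> k f + \<psi> k g"
          using fg A_add[OF fg] by (simp add: \<psi>_def add_divide_distrib)
      next
        fix c f assume f: "f \<in> A"
        have "complexified k (cscale c f) = c * complexified k f"
          unfolding cscale_def by (rule complexified_cscale[OF k(1) A_continuous[OF f]])
        then show "\<psi> k (cscale c f) = c * \<psi> k f"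
          using f A_cscale[OF f] by (simp add: \<psi>_def)
      qed
      moreover have "cmod (\<psi> k f) \<le> sup_norm f" if f: "f \<in> A" for f
        using cmod_complexified_le[OF k(1,2) A_continuous[OF f] cmod_le_sup_norm[OF f]] k(3) f
        by (simp add: \<psi>_def norm_divide pos_divide_le_eq)
      ultimately show ?thesis by (simp add: dual_ball_def \<psi>_def)
    qed
    define h' where "h' = (\<lambda>y. 1 - h y)"
    have b1: "\<psi> h \<in> dual_ball A" by (rule ball[OF h(1,2) 3(1)])
    have b2: "\<psi> h' \<in> dual_ball A"
      unfolding h'_def by (rule ball[OF c1]) (use h(3) l1 3 in auto)
    have eq: "eval_on A x = (\<lambda>f\<in>A. of_real (1 - \<Lambda> h') * \<psi> h f + of_real (\<Lambda> h') * \<psi> h' f)"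
      unfolding eval_on_def
    proof (rule restrict_ext)
      fix f assume f: "f \<in> A"
      then show "f x = of_real (1 - \<Lambda> h') * \<psi> h f + of_real (\<Lambda> h') * \<psi> h' f"
        using split[OF f] 3 l1 unfolding h'_def[symmetric] by (simp add: \<psi>_def)
    qed
    have same: "\<psi> h = \<psi> h'"
    proof (rule ccontr)
      assume "\<psi> h \<noteq> \<psi> h'"
      moreover have "0 < \<Lambda> h'" "\<Lambda> h' < 1" using 3 l1 unfolding h'_def by auto
      ultimately show False using x b1 b2 eq unfolding choquet_boundary_def by blast
    qed
    have "\<psi> h f = f x"
      using fun_cong[OF eq, of f] f unfolding same by (simp add: eval_on_def flip: distrib_right of_real_add)
    then show ?thesis using f 3 by (simp add: \<psi>_def field_simps)
  qed
qed


text \<open>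
  By extremality, a functional \<open>\<Lambda>\<close> that represents \<open>x\<close> vanishes on \<open>\<bar>f\<bar>\<^sup>2\<close> for all \<open>f \<in> A\<close> with \<open>f x = 0\<close>. If \<open>w x < 0\<close>,
  a finite sum of such functions is at least 1 wherever \<open>w \<ge> w x / 2\<close>, which forces \<open>\<Lambda> w < 0\<close>.
\<close>

lemma choquet_peak:
  assumes x: "x \<in> choquet_boundary A" and w: "continuous_on UNIV w"
    and cone: "\<And>t g. 0 \<le> t \<Longrightarrow> g \<in> A \<Longrightarrow> \<exists>y. Re (g x) \<le> t * w y + Re (g y)"
  shows "0 \<le> w x"
proof (rule ccontr)
  assume "\<not> 0 \<le> w x"
  then have neg: "w x < 0" by simp
  obtain \<Lambda> where pos: "positive_functional \<Lambda>" and \<Lambda>w: "0 \<le> \<Lambda> w"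
    and rep: "\<And>f. f \<in> A \<Longrightarrow> \<Lambda> (\<lambda>y. Re (f y)) = Re (f x)"
    using ex_representing_functional[OF w cone] by blast
  interpret positive_functional \<Lambda> by (rule pos)
  have cts: "continuous_on UNIV (\<lambda>y. Re (f y))" "continuous_on UNIV (\<lambda>y. Im (f y))"
    "continuous_on UNIV (\<lambda>y. (cmod (f y))\<^sup>2)" if "f \<in> A" for f
    using A_continuous[OF that] by (auto intro!: continuous_intros)
  \<comment> \<open>The affine change \<open>k\<close> moves \<open>h\<close> into
    \<open>[0, 1]\<close>, where \<open>choquet_extreme\<close> applies; linearity in the weight
    undoes it.\<close>
  have unit: "complexified h f = 0"
    if h: "continuous_on UNIV h" and f: "f \<in> A" "f x = 0" for h f
  proof -
    obtain B where B: "0 < B" "\<And>y. \<bar>h y\<bar> \<le> B" using bounded[OF h] by blast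
    define k where "k = (\<lambda>y. (1 / (2 * B)) * h y + 1 / 2)"
    have k: "continuous_on UNIV k" unfolding k_def using h by (intro continuous_intros)
    have "0 \<le> k y" "k y \<le> 1" for y
      using B(1) abs_le_D1[OF B(2)[of y]] abs_le_D2[OF B(2)[of y]] by (auto simp: k_def field_simps)
    then have "complexified k f = 0" using choquet_extreme[OF x pos rep k _ _ f(1)] f(2) by simp
    moreover have "complexified (\<lambda>_. 1 / 2) f = 0"
      using choquet_extreme[OF x pos rep continuous_on_const[of _ "1 / 2 :: real"] _ _ f(1)] f(2) by simp
    moreover have "complexified k f = complexified (\<lambda>y. (1 / (2 * B)) * h y) f + complexified (\<lambda>_. 1 / 2) f"
      unfolding k_def
      by (rule complexified_add_weight) (use h B(1) A_continuous[OF f(1)] in \<open>auto intro!: continuous_intros\<close>)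
    moreover have "complexified (\<lambda>y. (1 / (2 * B)) * h y) f = of_real (1 / (2 * B)) * complexified h f"
      by (rule complexified_scale_weight[OF h A_continuous[OF f(1)]])
    ultimately show ?thesis using B(1) by simp
  qed
  \<comment> \<open>Taking \<open>Re f\<close> and \<open>Im f\<close> themselves as weights in
    \<open>unit\<close> yields the two halves of the square.\<close>
  have sq: "\<Lambda> (\<lambda>y. (cmod (f y))\<^sup>2) = 0" if f: "f \<in> A" "f x = 0" for f
  proof -
    have "\<Lambda> (\<lambda>y. (cmod (f y))\<^sup>2) = \<Lambda> (\<lambda>y. Re (f y) * Re (f y) + Im (f y) * Im (f y))"
      by (simp only: cmod_power2) (simp only: power2_eq_square)
    also have "\<dots> = Re (complexified (\<lambda>y. Re (f y)) f) + Im (complexified (\<lambda>y. Im (f y)) f)"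
      using cts[OF f(1)] by (subst add) (auto simp: complexified_def intro!: continuous_intros)
    also have "\<dots> = 0" using unit[OF cts(1)[OF f(1)] f] unit[OF cts(2)[OF f(1)] f] by simp
    finally show ?thesis .
  qed
  define C where "C = {y. w x / 2 \<le> w y}"
  have "closed C"
    unfolding C_def using w by (intro closed_Collect_le) (auto intro!: continuous_intros)
  then have "compact C"
    using compact_Int_closed[OF compact_space, of C] by simp
  define K where "K = {f \<in> A. f x = 0}"
  have "C \<subseteq> (\<Union>f\<in>K. {y. 1 < (cmod (f y))\<^sup>2})"
  proof
    fix y assume "y \<in> C"
    then have "y \<noteq> x" using neg by (auto simp: C_def)
    then obtain f where f: "f \<in> A" "f y \<noteq> f x" using A_separates by blast
    \<comment> \<open>The value at \<open>y\<close> is scaled to 2, above 1, so that strict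
      inequalities give an open cover of \<open>C\<close>.\<close>
    define g where "g = cscale (2 / (f y - f x)) (f - (\<lambda>z. f x))"
    have "g \<in> K" using f by (simp add: K_def g_def A_cscale A_diff A_const)
    moreover have "g y = 2"
    proof -
      have "g y = 2 / (f y - f x) * (f y - f x)" by (simp only: g_def cscale_apply minus_apply)
      also have "\<dots> = 2" using f(2) by (simp only: times_divide_eq_left) (intro nonzero_mult_div_cancel_right, simp)
      finally show ?thesis .
    qed
    ultimately show "y \<in> (\<Union>f\<in>K. {y. 1 < (cmod (f y))\<^sup>2})" by (intro UN_I[of g]) auto
  qed
  moreover have "open {y. 1 < (cmod (f y))\<^sup>2}" if "f \<in> K" for f
    using cts(3)[of f] that by (intro open_Collect_less) (auto simp: K_def)
  ultimately obtain D where D: "D \<subseteq> K" "finite D" "C \<subseteq> (\<Union>f\<in>D. {y. 1 < (cmod (f y))\<^sup>2})"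
    using compactE_image[OF \<open>compact C\<close>, of K "\<lambda>f. {y. 1 < (cmod (f y))\<^sup>2}"] by blast
  define s where "s y = (\<Sum>f\<in>D. (cmod (f y))\<^sup>2)" for y
  have DA: "f \<in> A" "f x = 0" if "f \<in> D" for f using D(1) that by (auto simp: K_def)
  have s: "continuous_on UNIV s"
    unfolding s_def using cts(3)[OF DA(1)] by (intro continuous_on_sum)
  have "\<Lambda> (\<lambda>y. \<Sum>f\<in>E. (cmod (f y))\<^sup>2) = 0" if "E \<subseteq> D" for E
  proof -
    have "finite E" using that D(2) finite_subset by blast
    then show ?thesis using that
    proof (induction E)
      case (insert f E)
      have "continuous_on UNIV (\<lambda>y. \<Sum>f\<in>E. (cmod (f y))\<^sup>2)"
        using insert.prems by (intro continuous_on_sum cts(3) DA(1)) auto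
      then have "\<Lambda> (\<lambda>y. (cmod (f y))\<^sup>2 + (\<Sum>f\<in>E. (cmod (f y))\<^sup>2)) = 0"
        using insert add[OF cts(3)[OF DA(1)[of f]]] sq[OF DA(1)[of f] DA(2)[of f]] by simp
      then show ?case using insert.hyps by simp
    qed (use const[of 0] in simp)
  qed
  from this[OF order_refl] have s0: "\<Lambda> s = 0" by (simp add: s_def[abs_def])
  obtain B where B: "0 < B" "\<And>y. \<bar>w y\<bar> \<le> B" using bounded[OF w] by blast
  have s_nonneg: "0 \<le> s y" for y unfolding s_def by (simp add: sum_nonneg)
  have s_ge: "1 \<le> s y" if y: "y \<in> C" for y
  proof -
    obtain f where f: "f \<in> D" "1 < (cmod (f y))\<^sup>2" using D(3) y by blast
    have "(cmod (f y))\<^sup>2 \<le> s y" unfolding s_def by (rule member_le_sum[OF f(1)]) (auto simp: D(2))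
    then show ?thesis using f(2) by simp
  qed
  \<comment> \<open>With this factor, \<open>s \<ge> 1\<close> on \<open>C\<close> lifts
    \<open>w x / 2 + d * s\<close> to at least \<open>B\<close>, while off \<open>C\<close> already
    \<open>w < w x / 2\<close>.\<close>
  define d where "d = B - w x / 2"
  have d: "0 < d" using B(1) neg by (simp add: d_def)
  have "w y \<le> w x / 2 + d * s y" for y
  proof (cases "y \<in> C")
    case True
    have "d * 1 \<le> d * s y" using d s_ge[OF True] by (intro mult_left_mono) auto
    then show ?thesis using abs_le_D1[OF B(2)[of y]] by (simp add: d_def)
  next
    case False
    then show ?thesis using mult_nonneg_nonneg[OF less_imp_le[OF d] s_nonneg[of y]] by (simp add: C_def)
  qed
  then have "\<Lambda> w \<le> \<Lambda> (\<lambda>y. w x / 2 + d * s y)"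
    using w s by (intro mono) (auto intro!: continuous_intros)
  also have "\<dots> = \<Lambda> (\<lambda>_. w x / 2) + \<Lambda> (\<lambda>y. d * s y)"
    using s by (intro add) (auto intro!: continuous_intros)
  also have "\<dots> = w x / 2" using scale[OF s, of d] s0 const by simp
  finally show False using \<Lambda>w neg by simp
qed

end

subsection \<open>Multiplicative spectral functions\<close>

locale multiplicative_spectral = compact_banach_fun_alg A N
  for A :: "('a::topological_space \<Rightarrow> complex) set" and N +
  fixes \<phi> :: "('a \<Rightarrow> complex) \<Rightarrow> complex" and x\<^sub>0 :: 'a
  assumes natural: "natural A" and choquet: "choquet_boundary A = UNIV"
    and mult_on: "multiplicative_on A \<phi>" and spectral: "spectral_on A \<phi>"
    and assoc: "associated_point A \<phi> x\<^sub>0"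
begin

lemma phi_mult: "f \<in> A \<Longrightarrow> g \<in> A \<Longrightarrow> \<phi> (f * g) = \<phi> f * \<phi> g"
  using mult_on by (simp add: multiplicative_on_def)

lemma phi_exp: "f \<in> A \<Longrightarrow> \<phi> (exp \<circ> f) = exp (f x\<^sub>0)"
  using assoc by (simp add: associated_point_def)

lemma phi_range:
  assumes "f \<in> A" obtains y where "\<phi> f = f y"
  using spectral spectrum_subset_range[OF natural assms] assms
  unfolding spectral_on_def by blast

lemma phi_const: "\<phi> (\<lambda>x. c) = c"
  using phi_range[OF A_const[of c]] by metis

lemma phi_cscale:
  assumes "f \<in> A" shows "\<phi> (cscale c f) = c * \<phi> f"
proof -
  have "cscale c f = (\<lambda>x. c) * f" by (simp add: fun_eq_iff)
  then show ?thesis using phi_mult[OF A_const assms] phi_const by simp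
qed

text \<open>
  If \<open>\<bar>f x\<^sub>0\<bar> < \<delta> = \<bar>\<phi> f\<bar>\<close>, then \<open>w = \<bar>f\<bar> / \<delta> - 1\<close> is negative at \<open>x\<^sub>0\<close>. But \<open>e\<^sup>w \<ge> \<bar>f\<bar> / \<delta>\<close>, so evaluating \<open>\<phi>\<close>
  on \<open>f e\<^sup>g\<close> shows that \<open>w\<close> satisfies the hypothesis of \<open>choquet_peak\<close>.
\<close>

lemma cmod_phi_le:
  assumes f: "f \<in> A" shows "cmod (\<phi> f) \<le> cmod (f x\<^sub>0)"
proof (rule ccontr)
  assume "\<not> ?thesis"
  then have less: "cmod (f x\<^sub>0) < cmod (\<phi> f)" by simp
  define d where "d = cmod (\<phi> f)"
  have d: "0 < d" using less norm_ge_zero[of "f x\<^sub>0"] unfolding d_def by linarith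
  define w where "w y = cmod (f y) / d - 1" for y
  have "0 \<le> w x\<^sub>0"
  proof (rule choquet_peak)
    show "x\<^sub>0 \<in> choquet_boundary A" by (simp add: choquet)
    show "continuous_on UNIV w"
      unfolding w_def using d A_continuous[OF f] by (intro continuous_intros) auto
    fix t :: real and g assume t: "0 \<le> t" and g: "g \<in> A"
    show "\<exists>y. Re (g x\<^sub>0) \<le> t * w y + Re (g y)"
    proof (cases "t = 0")
      case False
      then have t: "0 < t" using t by simp
      \<comment> \<open>Division by \<open>t\<close> reduces the claim to \<open>w + Re h\<close>;
        for \<open>t = 0\<close> the point \<open>x\<^sub>0\<close> itself is a witness.\<close>
      define h where "h = cscale (of_real (1 / t)) g"
      have h: "h \<in> A" unfolding h_def by (rule A_cscale[OF g])
      obtain y where y: "\<phi> (f * (exp \<circ> h)) = (f * (exp \<circ> h)) y"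
        using phi_range[OF A_mult[OF f exp_in_A[OF h]]] .
      have "\<phi> f * exp (h x\<^sub>0) = f y * exp (h y)"
        using y phi_mult[OF f exp_in_A[OF h]] phi_exp[OF h] by simp
      then have "cmod (\<phi> f * exp (h x\<^sub>0)) = cmod (f y * exp (h y))" by simp
      then have "d * exp (Re (h x\<^sub>0)) = cmod (f y) * exp (Re (h y))"
        by (simp add: norm_mult d_def)
      also have "\<dots> \<le> (d * exp (w y)) * exp (Re (h y))"
        using exp_ge_add_one_self[of "w y"] d by (intro mult_right_mono) (auto simp: w_def field_simps)
      finally have "exp (Re (h x\<^sub>0)) \<le> exp (w y + Re (h y))"
        using d by (simp add: exp_add mult.assoc)
      then have "Re (g x\<^sub>0) / t \<le> w y + Re (g y) / t" by (simp add: h_def)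
      then have "Re (g x\<^sub>0) \<le> t * w y + Re (g y)" using t by (simp add: field_simps)
      then show ?thesis ..
    qed auto
  qed
  then show False using less d by (simp add: w_def d_def field_simps)
qed

lemma phi_zero: "f \<in> A \<Longrightarrow> f x\<^sub>0 = 0 \<Longrightarrow> \<phi> f = 0"
  using cmod_phi_le[of f] by simp

text \<open>Serves both parts: the first alternative gives the maximal ideal in (i); the second
  gives a sum with two terms and contradicts the span hypothesis in (ii).\<close>

lemma kernel_cases:
  obtains "kernel_on A \<phi> = {f \<in> A. f x\<^sub>0 = 0}"
  | g h where "g \<in> kernel_on A \<phi>" "h \<in> kernel_on A \<phi>" "1 = g + h"
proof (cases "kernel_on A \<phi> \<subseteq> {f \<in> A. f x\<^sub>0 = 0}")
  case True
  then have "kernel_on A \<phi> = {f \<in> A. f x\<^sub>0 = 0}" using phi_zero by (auto simp: kernel_on_def)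
  then show ?thesis by (rule that(1))
next
  case False
  then obtain f where f: "f \<in> A" "\<phi> f = 0" "f x\<^sub>0 \<noteq> 0" by (auto simp: kernel_on_def)
  define g where "g = cscale (1 / f x\<^sub>0) f"
  have g: "g \<in> A" unfolding g_def by (rule A_cscale[OF f(1)])
  have "g \<in> kernel_on A \<phi>"
    using g phi_cscale[OF f(1), of "1 / f x\<^sub>0"] f(2) by (simp add: kernel_on_def g_def)
  moreover have "1 - g \<in> kernel_on A \<phi>"
    using A_diff[OF A_one g] phi_zero[OF A_diff[OF A_one g]] f(3) by (simp add: kernel_on_def g_def)
  ultimately show ?thesis by (rule that(2)) simp
qed

text \<open>
  After scaling \<open>u\<close> so that \<open>u x\<^sub>0 = 1\<close>, put \<open>a = \<phi> u \<ge> 0\<close> and \<open>\<theta> = \<pi> / (1 - a)\<close>. Then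
  \<open>a = \<phi> (u exp (i\<theta>(1 - u)))\<close> must be a value of \<open>u exp (i\<theta>(1 - u))\<close>; but wherever this function has modulus \<open>a\<close>,
  it equals \<open>-a\<close>.
\<close>

lemma phi_nonneg_cases:
  assumes u: "u \<in> nonneg_part A"
  shows "\<phi> u = 0 \<or> \<phi> u = u x\<^sub>0"
proof (cases "u x\<^sub>0 = 0")
  case True
  then show ?thesis using phi_zero u by (auto simp: nonneg_part_def)
next
  case False
  have uA: "u \<in> A" and u_pos: "\<And>x. u x \<in> \<real>\<^sub>\<ge>\<^sub>0" using u by (auto simp: nonneg_part_def)
  define v where "v = cscale (1 / u x\<^sub>0) u"
  have v: "v \<in> A" unfolding v_def by (rule A_cscale[OF uA])
  have v_pos: "v x \<in> \<real>\<^sub>\<ge>\<^sub>0" for x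
    using u_pos[of x] u_pos[of x\<^sub>0] unfolding v_def
    by (auto simp: nonneg_Reals_divide_I)
  have v1: "v x\<^sub>0 = 1" using False by (simp add: v_def)
  obtain a where a: "0 \<le> a" "\<phi> v = of_real a"
    using phi_range[OF v] v_pos by (metis nonneg_Reals_cases)
  have "a = 0 \<or> a = 1"
  proof (rule ccontr)
    assume "\<not> ?thesis"
    then have ne: "a \<noteq> 0" "a \<noteq> 1" by auto
    define g where "g = cscale (\<i> * of_real (pi / (1 - a))) (1 - v)"
    have g: "g \<in> A" unfolding g_def by (rule A_cscale[OF A_diff[OF A_one v]])
    obtain y where y: "\<phi> (v * (exp \<circ> g)) = (v * (exp \<circ> g)) y"
      using phi_range[OF A_mult[OF v exp_in_A[OF g]]] .
    obtain s where s: "0 \<le> s" "v y = of_real s" using v_pos[of y] by (metis nonneg_Reals_cases)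
    have gy: "g y = \<i> * of_real (pi / (1 - a) * (1 - s))" by (simp add: g_def s)
    have "g x\<^sub>0 = 0" by (simp add: g_def v1)
    then have eq: "of_real a = of_real s * exp (g y)"
      using y phi_mult[OF v exp_in_A[OF g]] phi_exp[OF g] a(2) s(2) by simp
    then have "cmod (of_real a) = cmod (of_real s * exp (g y))" by simp
    then have "a = s" using a(1) s(1) by (simp add: norm_mult gy)
    then have "g y = \<i> * of_real pi" using ne(2) by (simp add: gy)
    then have "of_real a = - (of_real a :: complex)" using eq \<open>a = s\<close> exp_pi_i' by simp
    then show False using ne(1) by simp
  qed
  moreover have "\<phi> v = \<phi> u / u x\<^sub>0" unfolding v_def phi_cscale[OF uA] by simp
  ultimately show ?thesis using a(2) False by (auto simp: field_simps)
qed

text \<open>The hypothesis \<open>nonneg\<close> is what each alternative of (ii) supplies. Applied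
  to \<open>f * (cnj \<circ> f)\<close>, it fixes a product of moduli; since
  \<open>|\<phi> (cnj \<circ> f)|\<close> cannot exceed \<open>|f x\<^sub>0|\<close>, the other
  factor \<open>|\<phi> f|\<close> cannot fall below it.\<close>

lemma phi_eq_of_selfadjoint:
  assumes bishop: "bishop_property A" and f: "f \<in> A" and cf: "cnj \<circ> f \<in> A"
    and nonneg: "\<And>u. u \<in> nonneg_part A \<Longrightarrow> u x\<^sub>0 \<noteq> 0 \<Longrightarrow> \<phi> u = u x\<^sub>0"
  shows "\<phi> f = f x\<^sub>0"
proof (cases "f x\<^sub>0 = 0")
  case True
  then show ?thesis using phi_zero[OF f] by simp
next
  case False
  have "f * (cnj \<circ> f) \<in> nonneg_part A"
    using A_mult[OF f cf] by (auto simp: nonneg_part_def complex_norm_square[symmetric])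
  then have prod: "\<phi> f * \<phi> (cnj \<circ> f) = f x\<^sub>0 * cnj (f x\<^sub>0)"
    using nonneg[of "f * (cnj \<circ> f)"] phi_mult[OF f cf] False by simp
  have "cmod (f x\<^sub>0) * cmod (f x\<^sub>0) = cmod (\<phi> f) * cmod (\<phi> (cnj \<circ> f))"
    using arg_cong[OF prod, of cmod] by (simp add: norm_mult)
  also have "\<dots> \<le> cmod (\<phi> f) * cmod (f x\<^sub>0)"
    using cmod_phi_le[OF cf] by (intro mult_left_mono) auto
  finally have ge: "cmod (f x\<^sub>0) \<le> cmod (\<phi> f)" using False by simp
  obtain g where g: "g \<in> peaking_at A x\<^sub>0" "g \<in> exp_set A \<union> nonneg_part A"
    and h: "cscale (1 / f x\<^sub>0) (f * g) \<in> peaking_at A x\<^sub>0"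
    using bishop f False choquet unfolding bishop_property_def by blast
  have gA: "g \<in> A" and g1: "g x\<^sub>0 = 1" using g(1) by (auto simp: peaking_at_def)
  \<comment> \<open>The Bishop property offers a \<open>g\<close> at which \<open>\<phi>\<close> is
    known: an exponential through the associated point, a nonnegative one through
    \<open>nonneg\<close>.\<close>
  have "\<phi> g = 1"
    using g(2)
  proof
    assume "g \<in> exp_set A"
    then obtain k where k: "k \<in> A" "g = exp \<circ> k" by (auto simp: exp_set_def)
    then show ?thesis using phi_exp[OF k(1)] g1 by simp
  qed (use nonneg g1 in simp)
  then have phi_h: "\<phi> (cscale (1 / f x\<^sub>0) (f * g)) = \<phi> f / f x\<^sub>0"
    using phi_cscale[OF A_mult[OF f gA]] phi_mult[OF f gA] by simp
  have "cscale (1 / f x\<^sub>0) (f * g) \<in> A" using h by (simp add: peaking_at_def)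
  then obtain y where y: "\<phi> f / f x\<^sub>0 = cscale (1 / f x\<^sub>0) (f * g) y"
    using phi_range phi_h by metis
  have "\<phi> f / f x\<^sub>0 \<in> {z. cmod z < 1} \<union> {1}"
    using h unfolding y peaking_at_def by blast
  moreover have "\<not> cmod (\<phi> f / f x\<^sub>0) < 1"
    using ge False by (simp add: norm_divide pos_divide_less_eq)
  ultimately have "\<phi> f / f x\<^sub>0 = 1" by simp
  then show ?thesis using False by simp
qed

text \<open>The function \<open>u + 1 / (n + 1)\<close> has no zeros, so \<open>\<phi>\<close> is
  nonzero there and \<open>phi_nonneg_cases\<close> leaves only the value at
  \<open>x\<^sub>0\<close>; continuity passes to the limit \<open>u\<close>.\<close>

lemma phi_nonneg_of_continuous:
  assumes cont: "continuous_map (Metric_space.mtopology A (ndist A N)) euclidean \<phi>"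
    and u: "u \<in> nonneg_part A"
  shows "\<phi> u = u x\<^sub>0"
proof -
  interpret Metric_space A "ndist A N"
    using Metric_space_ndist[OF fa norm_on] .
  have uA: "u \<in> A" and u_pos: "\<And>x. u x \<in> \<real>\<^sub>\<ge>\<^sub>0" using u by (auto simp: nonneg_part_def)
  define c where "c n = (\<lambda>x::'a. of_real (inverse (real (Suc n))) :: complex)" for n
  define v where "v n = u + c n" for n
  have c: "c n \<in> A" for n unfolding c_def by (rule A_const)
  have v: "v n \<in> A" for n unfolding v_def by (rule A_add[OF uA c])
  have v_eq: "\<phi> (v n) = u x\<^sub>0 + of_real (inverse (real (Suc n)))" for n
  proof -
    have pos: "v n x \<in> \<real>\<^sub>\<ge>\<^sub>0" "v n x \<noteq> 0" for x
    proof -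
      obtain s where s: "0 \<le> s" "u x = of_real s" using u_pos[of x] by (metis nonneg_Reals_cases)
      have eq: "v n x = of_real (s + inverse (real (Suc n)))" by (simp add: v_def c_def s)
      have gt: "0 < s + inverse (real (Suc n))" using s(1) by (simp add: add_nonneg_pos)
      show "v n x \<in> \<real>\<^sub>\<ge>\<^sub>0" unfolding eq nonneg_Reals_of_real_iff using gt by simp
      show "v n x \<noteq> 0" unfolding eq of_real_eq_0_iff using gt by linarith
    qed
    obtain y where "\<phi> (v n) = v n y" using phi_range[OF v] .
    then have "\<phi> (v n) \<noteq> 0" using pos(2) by simp
    then have "\<phi> (v n) = v n x\<^sub>0"
      using phi_nonneg_cases[of "v n"] v pos(1) by (simp add: nonneg_part_def)
    then show ?thesis by (simp add: v_def c_def)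
  qed
  have c0: "(\<lambda>n. inverse (real (Suc n))) \<longlonglongrightarrow> 0" by (rule LIMSEQ_inverse_real_of_nat)
  have Nc: "ndist A N (v n) u = inverse (real (Suc n)) * N 1" for n
  proof -
    have "v n - u = cscale (of_real (inverse (real (Suc n)))) 1"
      by (simp add: v_def c_def fun_eq_iff)
    then show ?thesis
      using N_cscale[OF A_one, of "of_real (inverse (real (Suc n)))"] v uA
      by (simp add: ndist_def norm_inverse del: of_nat_Suc of_real_inverse)
  qed
  have "(\<lambda>n. inverse (real (Suc n)) * N 1) \<longlonglongrightarrow> 0"
    using tendsto_mult_left_zero[OF c0] .
  then have "(\<lambda>n. ndist A N (v n) u) \<longlonglongrightarrow> 0" by (simp only: Nc)
  then have "\<forall>\<^sub>F n in sequentially. ndist A N (v n) u < e" if "e > 0" for e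
    using that by (rule order_tendstoD)
  then have "limitin mtopology v u sequentially"
    unfolding limitin_metric using uA v by (simp add: eventually_conj_iff)
  from continuous_map_limit[OF cont this]
  have "(\<lambda>n. \<phi> (v n)) \<longlonglongrightarrow> \<phi> u" by (simp add: o_def)
  moreover have "(\<lambda>n. u x\<^sub>0 + of_real (inverse (real (Suc n)))) \<longlonglongrightarrow> u x\<^sub>0 + of_real 0"
    by (intro tendsto_intros c0)
  ultimately show ?thesis
    unfolding v_eq using LIMSEQ_unique by fastforce
qed

end

theorem theorem3p7:
  fixes A :: "('a::t2_space \<Rightarrow> complex) set"
    and N :: "('a \<Rightarrow> complex) \<Rightarrow> real"
    and \<phi> :: "('a \<Rightarrow> complex) \<Rightarrow> complex"
    and x\<^sub>0 :: 'a
  assumes "compact (UNIV :: 'a set)"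
    and "banach_function_algebra A N"
    and "natural A"
    and "choquet_boundary A = UNIV"
    and "multiplicative_on A \<phi>"
    and "spectral_on A \<phi>"
    and "associated_point A \<phi> x\<^sub>0"
  shows "(maximalideal (kernel_on A \<phi>) (fun_ring A) \<or>
            (\<exists>(n::nat) f. (\<forall>i\<in>{1..n}. f i \<in> kernel_on A \<phi>) \<and> 1 = (\<Sum>i=1..n. f i))) \<and>
         (bishop_property A \<longrightarrow>
            1 \<notin> cspan (kernel_on A \<phi>) \<or>
              continuous_map (Metric_space.mtopology A (ndist A N)) euclidean \<phi> \<longrightarrow>
            (\<forall>f\<in>A. cnj \<circ> f \<in> A \<longrightarrow> \<phi> f = f x\<^sub>0))"
proof -
  interpret multiplicative_spectral A N \<phi> x\<^sub>0
    by unfold_locales (fact assms)+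
  interpret S: vector_space "cscale :: complex \<Rightarrow> ('a \<Rightarrow> complex) \<Rightarrow> _"
    by (rule vector_space_cscale)
  show ?thesis
  proof (intro conjI impI ballI)
    show "maximalideal (kernel_on A \<phi>) (fun_ring A) \<or>
        (\<exists>(n::nat) f. (\<forall>i\<in>{1..n}. f i \<in> kernel_on A \<phi>) \<and> 1 = (\<Sum>i=1..n. f i))"
    proof (cases rule: kernel_cases)
      case 1
      show ?thesis unfolding 1 by (rule disjI1[OF maximalideal_evaluation])
    next
      case (2 g h)
      define k where "k i = (if i = 1 then g else h)" for i :: nat
      have "{1..2} = {1, 2 :: nat}" by auto
      then have "1 = (\<Sum>i=1..2. k i)" using 2(3) by (simp add: k_def)
      moreover have "\<forall>i\<in>{1..2}. k i \<in> kernel_on A \<phi>" using 2(1,2) by (simp add: k_def)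
      ultimately show ?thesis by blast
    qed
  next
    fix f
    assume bishop: "bishop_property A"
      and or: "1 \<notin> cspan (kernel_on A \<phi>) \<or>
        continuous_map (Metric_space.mtopology A (ndist A N)) euclidean \<phi>"
      and f: "f \<in> A" "cnj \<circ> f \<in> A"
    show "\<phi> f = f x\<^sub>0"
    proof (rule phi_eq_of_selfadjoint[OF bishop f])
      fix u assume u: "u \<in> nonneg_part A" "u x\<^sub>0 \<noteq> 0"
      show "\<phi> u = u x\<^sub>0"
        using or
      proof
        assume span: "1 \<notin> cspan (kernel_on A \<phi>)"
        \<comment> \<open>In the first case \<open>\<phi> u = 0\<close> would put \<open>u\<close>
          in the kernel and force \<open>u x\<^sub>0 = 0\<close>; in the second, 1 would lie in the
          span of the kernel.\<close>
        have "\<phi> u \<noteq> 0"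
        proof (cases rule: kernel_cases)
          case 1
          then show ?thesis using u by (auto simp: kernel_on_def nonneg_part_def)
        next
          case (2 g h)
          then show ?thesis using span S.span_add[OF S.span_base S.span_base] by metis
        qed
        then show ?thesis using phi_nonneg_cases[OF u(1)] by blast
      qed (rule phi_nonneg_of_continuous[OF _ u(1)])
    qed
  qed
qed

end
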